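(* For each $n\ge1$ let $A=A_n=(A_{ij})_{1\le i,j\le n}$ be a real symmetric matrix all of whose off-diagonal entries are nonnegative, let $h=h_n\in\mathbb{R}^n$, and let $X=(X_1,\dots,X_n)^\top$ follow the Ising model $P(X=x)\propto\exp(\frac12x^\top A_nx+h_n^\top x)$, $x\in\{-1,1\}^n$. Let $\alpha_n:=\sup_{1\le i\le n}\sum_{j\ne i}|A_{ij}|$ and assume that $\sup_{n\ge1}\alpha_n\le\alpha<1$ for some constant $\alpha$. Let $W_n=\frac{1}{\sqrt n}\sum_{i=1}^nX_i$, $\mu_n:=\mathbb{E}(W_n)$, $\sigma_n^2:=\mathrm{Var}(W_n)$. Then, as $n\to\infty$, $$\mathcal{W}_2(\mathcal{L}(W_n),N(\mu_n,\sigma_n^2))\to0.$$ If, in addition, $\|h_n\|_\infty$ is bounded by a universal constant (uniformly in $n$), then $$\frac{W_n-\mu_n}{\sigma_n}\to N(0,1)\quad\text{in distribution.}$$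
   Context: The matrix $A_n$ and field $h_n$ may depend on $n$; changing the diagonal entries of $A_n$ does not change the model. $\mathcal{L}(W)$ is the law of $W$, $N(\mu,\sigma^2)$ the normal distribution, and $\mathcal{W}_2(\mu,\nu):=\inf(\mathbb{E}|X-Y|^2)^{1/2}$ over all couplings $(X,Y)$ of $X\sim\mu$, $Y\sim\nu$. *)

theory Defs
  imports "HOL-Probability.Probability"
begin

definition spin_configs :: "nat \<Rightarrow> (nat \<Rightarrow> real) set" where
  "spin_configs n = {1..n} \<rightarrow>\<^sub>E {-1, 1}"

text \<open>Unnormalised Gibbs weight \<open>exp (x\<^sup>T A x / 2 + h\<^sup>T x)\<close>.
  The double sum includes the diagonal.\<close>

definition ising_weight ::
    "nat \<Rightarrow> (nat \<Rightarrow> nat \<Rightarrow> real) \<Rightarrow> (nat \<Rightarrow> real) \<Rightarrow> (nat \<Rightarrow> real) \<Rightarrow> real" where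
  "ising_weight n A h x =
     exp ((\<Sum>i=1..n. \<Sum>j=1..n. x i * A i j * x j) / 2 + (\<Sum>i=1..n. h i * x i))"

text \<open>The vector \<open>(X 1, \<dots>, X n)\<close> on the probability space \<open>M\<close> follows the Ising model.
  The prescribed probabilities add up to 1, so the vector lies in \<open>{-1, 1}\<^sup>n\<close> almost surely;
  no condition is imposed on \<open>X i\<close> for \<open>i\<close> outside \<open>{1..n}\<close>.\<close>

definition follows_ising ::
    "'a measure \<Rightarrow> nat \<Rightarrow> (nat \<Rightarrow> nat \<Rightarrow> real) \<Rightarrow> (nat \<Rightarrow> real) \<Rightarrow> (nat \<Rightarrow> 'a \<Rightarrow> real) \<Rightarrow> bool" where
  "follows_ising M n A h X \<longleftrightarrow>
     prob_space M \<and>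
     (\<forall>i\<in>{1..n}. X i \<in> borel_measurable M) \<and>
     (\<forall>x\<in>spin_configs n.
        measure M {\<omega> \<in> space M. \<forall>i\<in>{1..n}. X i \<omega> = x i} =
          ising_weight n A h x / (\<Sum>y\<in>spin_configs n. ising_weight n A h y))"

definition max_offdiag_row_sum :: "nat \<Rightarrow> (nat \<Rightarrow> nat \<Rightarrow> real) \<Rightarrow> real" where
  "max_offdiag_row_sum n A = (SUP i\<in>{1..n}. \<Sum>j\<in>{1..n} - {i}. \<bar>A i j\<bar>)"

definition scaled_magnetization :: "nat \<Rightarrow> (nat \<Rightarrow> 'a \<Rightarrow> real) \<Rightarrow> 'a \<Rightarrow> real" where
  "scaled_magnetization n X \<omega> = (\<Sum>i=1..n. X i \<omega>) / sqrt (real n)"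

text \<open>Normal law with mean \<open>m\<close> and variance \<open>v\<close>. The case \<open>v = 0\<close> is separate because
  \<^const>\<open>normal_density\<close> with standard deviation 0 vanishes identically.\<close>

definition normal_law :: "real \<Rightarrow> real \<Rightarrow> real measure" where
  "normal_law m v =
     (if v = 0 then return borel m else density lborel (normal_density m (sqrt v)))"

definition couplings :: "real measure \<Rightarrow> real measure \<Rightarrow> (real \<times> real) measure set" where
  "couplings \<mu> \<nu> = {\<gamma>. prob_space \<gamma> \<and> sets \<gamma> = sets (borel \<Otimes>\<^sub>M borel) \<and>
     distr \<gamma> borel fst = \<mu> \<and> distr \<gamma> borel snd = \<nu>}"

text \<open>The value is extended, so that a law without second moment is not mistaken for
  one at distance 0.\<close>

definition ennreal_sqrt :: "ennreal \<Rightarrow> ennreal" where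
  "ennreal_sqrt x = (if x = \<infinity> then \<infinity> else ennreal (sqrt (enn2real x)))"

definition wasserstein2 :: "real measure \<Rightarrow> real measure \<Rightarrow> ennreal" where
  "wasserstein2 \<mu> \<nu> =
     (INF \<gamma>\<in>couplings \<mu> \<nu>. ennreal_sqrt (\<integral>\<^sup>+ (x, y). ennreal (\<bar>x - y\<bar>\<^sup>2) \<partial>\<gamma>))"

end

theory Submission imports Defs begin

text \<open>
  Let \<open>L\<close> be the generator of the Glauber dynamics, which resamples each spin at rate 1 from its
  conditional law given the others. The row sum condition makes the dynamics contract discrete
  gradients, so the Poisson equation \<open>-L F = S - E S\<close> for the magnetization \<open>S\<close> has a solution.
  Differencing this equation in one or two spins again gives an equation with a jump generator, and
  the maximum principle bounds the first differences \<open>D\<^sub>i F\<close> and the row sums of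
  \<open>\<bar>D\<^sub>j D\<^sub>i F\<bar>\<close> uniformly in \<open>n\<close> and in the external field. By reversibility
  \<open>E[(S - E S) g(S)] = E[\<Sum>\<^sub>i v\<^sub>i (D\<^sub>i F) (D\<^sub>i g(S))]\<close>, which is
  \<open>2 E[T g'(S)]\<close> up to Taylor error, where \<open>T = \<Sum>\<^sub>i v\<^sub>i D\<^sub>i F\<close> has mean \<open>Var S / 2\<close> and,
  by the second-order bound, variance of order \<open>n\<close>. Hence \<open>S\<close> satisfies Stein's identity
  approximately, and for \<open>g = sin, cos\<close> this is a perturbed differential equation for the
  characteristic function of the standardized magnetization. Ferromagnetism gives \<open>D\<^sub>i F \<ge> 2\<close>,
  which bounds the variance from below. For the Wasserstein distance, indices with small
  \<open>\<sigma>\<^sub>n\<close> are handled by an arbitrary coupling, the others by Skorohod's theorem, the second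
  moments being equal.
\<close>

subsection \<open>Jump generators on spin configurations\<close>

text \<open>The discrete derivative without the factor 1/2, so that a single spin has derivative
  2.\<close>

definition spin_diff :: "nat \<Rightarrow> ((nat \<Rightarrow> real) \<Rightarrow> real) \<Rightarrow> (nat \<Rightarrow> real) \<Rightarrow> real" where
  "spin_diff i f x = f (x(i := 1)) - f (x(i := -1))"

text \<open>Generator of the jump process in which every site of \<open>I\<close> rings at rate 1
  and its spin is then set to 1 with probability \<open>q i x\<close> and to -1 otherwise.
  \<open>I\<close> and \<open>q\<close> stay free because differencing in a spin gives a generator
  of the same kind, with one site removed and other rates.\<close>

definition flip_gen ::
    "nat set \<Rightarrow> (nat \<Rightarrow> (nat \<Rightarrow> real) \<Rightarrow> real) \<Rightarrow> ((nat \<Rightarrow> real) \<Rightarrow> real) \<Rightarrow> (nat \<Rightarrow> real) \<Rightarrow> real" where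
  "flip_gen I q g x = (\<Sum>i\<in>I. q i x * g (x(i := 1)) + (1 - q i x) * g (x(i := -1)) - g x)"

lemma spin_diff_upd_same [simp]: "spin_diff i f (x(i := a)) = spin_diff i f x"
  by (simp add: spin_diff_def)

lemma spin_diff_commute: "spin_diff i (spin_diff j f) x = spin_diff j (spin_diff i f) x"
  by (cases "i = j") (simp_all add: spin_diff_def fun_upd_twist)

lemma spin_diff_mult:
  "spin_diff i (\<lambda>x. f x * g x) x =
     spin_diff i f x * g (x(i := 1)) + f (x(i := -1)) * spin_diff i g x"
  by (simp add: spin_diff_def algebra_simps)

lemma spin_diff_sum: "spin_diff i (\<lambda>x. \<Sum>k\<in>I. f k x) x = (\<Sum>k\<in>I. spin_diff i (f k) x)"
  by (simp add: spin_diff_def sum_subtractf)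

text \<open>Commutation of differencing and generator. At a site \<open>i\<close> other than
  \<open>k\<close>, the product rule gives the same kind of term for \<open>spin_diff k g\<close>,
  with the rate frozen at spin \<open>k\<close> = 1, and a source from the dependence of
  \<open>q i\<close> on spin \<open>k\<close>. At site \<open>k\<close> the update forgets the old
  spin, so only the loss term \<open>- g x\<close> is differenced; this acts as killing at rate
  1.\<close>

lemma spin_diff_flip_gen:
  assumes "finite I" and q: "k \<in> I \<Longrightarrow> q k (x(k := 1)) = q k (x(k := -1))"
  shows "spin_diff k (flip_gen I q g) x =
    flip_gen (I - {k}) (\<lambda>i y. q i (y(k := 1))) (spin_diff k g) x
    + (\<Sum>i\<in>I - {k}. spin_diff k (q i) x * spin_diff i g (x(k := -1)))
    - (if k \<in> I then spin_diff k g x else 0)"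
proof -
  define t where "t i y = q i y * g (y(i := 1)) + (1 - q i y) * g (y(i := -1)) - g y" for i y
  have other: "spin_diff k (t i) x =
      (q i (x(k := 1)) * spin_diff k g (x(i := 1))
        + (1 - q i (x(k := 1))) * spin_diff k g (x(i := -1)) - spin_diff k g x)
      + spin_diff k (q i) x * spin_diff i g (x(k := -1))" if "i \<in> I - {k}" for i
  proof -
    have "i \<noteq> k" using that by auto
    then show ?thesis
      by (simp add: t_def spin_diff_def fun_upd_twist[of i k] algebra_simps)
  qed
  have self: "spin_diff k (t k) x = - spin_diff k g x" if "k \<in> I"
    using q[OF that] by (simp add: t_def spin_diff_def algebra_simps)
  have "spin_diff k (flip_gen I q g) x = (\<Sum>i\<in>I. spin_diff k (t i) x)"
    by (simp add: spin_diff_def flip_gen_def t_def sum_subtractf)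
  also have "\<dots> = (\<Sum>i\<in>I - {k}. spin_diff k (t i) x) + (if k \<in> I then spin_diff k (t k) x else 0)"
    using assms(1) by (simp add: sum.remove)
  finally show ?thesis
    using self by (simp add: other sum.distrib flip_gen_def)
qed

text \<open>Where \<open>u\<close> is maximal, the generator compares averages of \<open>u\<close>
  with its maximum and is therefore nonpositive, so the equation gives \<open>c * u \<le> r\<close>
  there.\<close>

lemma flip_gen_max_principle:
  assumes "finite I" "finite \<Omega>"
    and stable: "\<And>x i. x \<in> \<Omega> \<Longrightarrow> i \<in> I \<Longrightarrow> x(i := 1) \<in> \<Omega> \<and> x(i := -1) \<in> \<Omega>"
    and q: "\<And>x i. x \<in> \<Omega> \<Longrightarrow> i \<in> I \<Longrightarrow> 0 \<le> q i x \<and> q i x \<le> 1"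
    and eq: "\<And>x. x \<in> \<Omega> \<Longrightarrow> c * u x = r x + flip_gen I q u x"
    and r: "\<And>x. x \<in> \<Omega> \<Longrightarrow> r x \<le> R" and "0 \<le> c" "y \<in> \<Omega>"
  shows "c * u y \<le> R"
proof -
  have "Max (u ` \<Omega>) \<in> u ` \<Omega>"
    using assms by (intro Max_in) auto
  then obtain z where z: "z \<in> \<Omega>" "u z = Max (u ` \<Omega>)" by auto
  have max: "u x \<le> u z" if "x \<in> \<Omega>" for x
    using that assms(2) z(2) by simp
  have "flip_gen I q u z \<le> 0"
    unfolding flip_gen_def
  proof (rule sum_nonpos)
    fix i assume "i \<in> I"
    then have "q i z * u (z(i := 1)) \<le> q i z * u z" "(1 - q i z) * u (z(i := -1)) \<le> (1 - q i z) * u z"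
      using stable[OF z(1)] q[OF z(1)] by (auto intro!: mult_left_mono max)
    then show "q i z * u (z(i := 1)) + (1 - q i z) * u (z(i := -1)) - u z \<le> 0"
      by (simp add: algebra_simps)
  qed
  then have "c * u z \<le> R" using eq[OF z(1)] r[OF z(1)] by simp
  moreover have "c * u y \<le> c * u z" using max[OF \<open>y \<in> \<Omega>\<close>] \<open>0 \<le> c\<close> by (rule mult_left_mono)
  ultimately show ?thesis by simp
qed

lemma flip_gen_uminus: "flip_gen I q (\<lambda>x. - u x) x = - flip_gen I q u x"
  by (simp add: flip_gen_def algebra_simps flip: sum_negf)

lemma flip_gen_abs_max_principle:
  assumes "finite I" "finite \<Omega>"
    and "\<And>x i. x \<in> \<Omega> \<Longrightarrow> i \<in> I \<Longrightarrow> x(i := 1) \<in> \<Omega> \<and> x(i := -1) \<in> \<Omega>"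
    and "\<And>x i. x \<in> \<Omega> \<Longrightarrow> i \<in> I \<Longrightarrow> 0 \<le> q i x \<and> q i x \<le> 1"
    and eq: "\<And>x. x \<in> \<Omega> \<Longrightarrow> c * u x = r x + flip_gen I q u x"
    and r: "\<And>x. x \<in> \<Omega> \<Longrightarrow> \<bar>r x\<bar> \<le> R" and "0 \<le> c" "y \<in> \<Omega>"
  shows "c * \<bar>u y\<bar> \<le> R"
proof -
  have "c * u y \<le> R"
    by (rule flip_gen_max_principle[OF assms(1-5)]) (use assms in force)+
  moreover have "c * (- u y) \<le> R"
    by (rule flip_gen_max_principle[where u = "\<lambda>x. - u x" and r = "\<lambda>x. - r x", OF assms(1-4)])
      (use assms in \<open>force simp: flip_gen_uminus eq\<close>)+
  ultimately show ?thesis by (auto simp: abs_if)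
qed

section \<open>First and second differences of tanh\<close>

lemma tanh_real_deriv: "(tanh has_real_derivative 1 - (tanh x)\<^sup>2) (at (x::real))"
  by (rule has_field_derivative_tanh[where g = "\<lambda>x. x" and Db = 1, simplified]) auto

lemma tanh_square_le_1: "(tanh (x::real))\<^sup>2 \<le> 1"
  using tanh_real_bounds[of x] by (simp add: abs_square_le_1 abs_le_iff)

lemma tanh_lipschitz: "\<bar>tanh x - tanh y\<bar> \<le> \<bar>x - y\<bar>" for x y :: real
proof -
  have "norm (tanh x - tanh y) \<le> 1 * norm (x - y)"
    by (rule field_differentiable_bound[of UNIV tanh "\<lambda>x. 1 - (tanh x)\<^sup>2"])
      (use tanh_square_le_1 in \<open>auto intro: tanh_real_deriv has_field_derivative_at_within\<close>)
  then show ?thesis by simp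
qed

text \<open>Mean value inequality for \<open>tanh (x + b) - tanh x\<close>: its derivative is a
  difference of two squares of tanh, with one factor at most \<open>\<bar>b\<bar>\<close> and the
  other at most 2.\<close>

lemma tanh_second_difference:
  "\<bar>(tanh (s + a + b) - tanh (s + a)) - (tanh (s + b) - tanh s)\<bar> \<le> 2 * \<bar>a\<bar> * \<bar>b\<bar>" for s a b :: real
proof -
  let ?f = "\<lambda>x. tanh (x + b) - tanh x"
  let ?f' = "\<lambda>x. (1 - (tanh (x + b))\<^sup>2) - (1 - (tanh x)\<^sup>2)"
  have "norm (?f (s + a) - ?f s) \<le> (2 * \<bar>b\<bar>) * norm ((s + a) - s)"
  proof (rule field_differentiable_bound[of UNIV ?f ?f'])
    fix x :: real
    show "(?f has_field_derivative ?f' x) (at x within UNIV)"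
      by (auto intro!: derivative_eq_intros)
    have "?f' x = (tanh x - tanh (x + b)) * (tanh x + tanh (x + b))"
      by (simp add: algebra_simps power2_eq_square)
    moreover have "\<bar>tanh x - tanh (x + b)\<bar> \<le> \<bar>b\<bar>"
      using tanh_lipschitz[of x "x + b"] by simp
    moreover have "\<bar>tanh x + tanh (x + b)\<bar> \<le> 2"
      using tanh_real_bounds[of x] tanh_real_bounds[of "x + b"] by auto
    ultimately have "\<bar>?f' x\<bar> \<le> \<bar>b\<bar> * 2"
      unfolding abs_mult by (metis abs_ge_zero abs_mult mult_mono)
    then show "norm (?f' x) \<le> 2 * \<bar>b\<bar>" by simp
  qed auto
  then show ?thesis by (simp add: algebra_simps)
qed

lemma sum_sum_swap_diff:
  fixes f :: "nat \<Rightarrow> nat \<Rightarrow> real"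
  assumes "finite B"
  shows "(\<Sum>k\<in>B. \<Sum>i\<in>B - {k}. f i k) = (\<Sum>i\<in>B. \<Sum>k\<in>B - {i}. f i k)"
proof -
  have "(\<Sum>k\<in>B. \<Sum>i\<in>{i\<in>B. i \<noteq> k}. f i k) = (\<Sum>i\<in>B. \<Sum>k\<in>{k\<in>B. i \<noteq> k}. f i k)"
    using assms by (intro sum.swap_restrict)
  moreover have "{i\<in>B. i \<noteq> k} = B - {k}" "{i\<in>B. k \<noteq> i} = B - {k}" for k by auto
  ultimately show ?thesis by simp
qed

subsection \<open>Glauber dynamics of the Ising model\<close>

locale high_temp_ising =
  fixes n :: nat and A :: "nat \<Rightarrow> nat \<Rightarrow> real" and h :: "nat \<Rightarrow> real" and \<alpha> :: real
  assumes n_pos: "1 \<le> n"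
    and A_sym: "i \<in> {1..n} \<Longrightarrow> j \<in> {1..n} \<Longrightarrow> A i j = A j i"
    and A_nonneg: "i \<in> {1..n} \<Longrightarrow> j \<in> {1..n} \<Longrightarrow> i \<noteq> j \<Longrightarrow> 0 \<le> A i j"
    and row_sum: "i \<in> {1..n} \<Longrightarrow> (\<Sum>j\<in>{1..n} - {i}. A i j) \<le> \<alpha>"
    and \<alpha>_less_1: "\<alpha> < 1"
begin

abbreviation \<Omega> :: "(nat \<Rightarrow> real) set" where "\<Omega> \<equiv> spin_configs n"

definition local_field :: "nat \<Rightarrow> (nat \<Rightarrow> real) \<Rightarrow> real" where
  "local_field i x = h i + (\<Sum>j\<in>{1..n} - {i}. A i j * x j)"

text \<open>The conditional probability that spin \<open>i\<close> is 1 given the other spins, as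
  \<open>detailed_balance\<close> confirms.\<close>

definition plus_prob :: "nat \<Rightarrow> (nat \<Rightarrow> real) \<Rightarrow> real" where
  "plus_prob i x = (1 + tanh (local_field i x)) / 2"

text \<open>Conditional variance of the indicator of spin \<open>i\<close> being 1, a quarter of
  that of the spin itself. These are the weights of the Dirichlet form.\<close>

definition cond_var :: "nat \<Rightarrow> (nat \<Rightarrow> real) \<Rightarrow> real" where
  "cond_var i x = plus_prob i x * (1 - plus_prob i x)"

definition gibbs :: "(nat \<Rightarrow> real) \<Rightarrow> real" where
  "gibbs x = ising_weight n A h x / (\<Sum>y\<in>\<Omega>. ising_weight n A h y)"

text \<open>Gibbs expectation as a finite sum. The analysis is done on the configuration space;
  \<open>ising_integral\<close> transfers it to the probability space of the random vector.\<close>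

definition ex :: "((nat \<Rightarrow> real) \<Rightarrow> real) \<Rightarrow> real" where
  "ex f = (\<Sum>x\<in>\<Omega>. gibbs x * f x)"

definition glauber :: "((nat \<Rightarrow> real) \<Rightarrow> real) \<Rightarrow> (nat \<Rightarrow> real) \<Rightarrow> real" where
  "glauber = flip_gen {1..n} plus_prob"

lemma \<alpha>_nonneg: "0 \<le> \<alpha>"
proof -
  have "0 \<le> (\<Sum>j\<in>{1..n} - {1}. A 1 j)" using n_pos by (intro sum_nonneg A_nonneg) auto
  also have "\<dots> \<le> \<alpha>" using n_pos by (intro row_sum) auto
  finally show ?thesis .
qed

section \<open>Configurations and Gibbs expectations\<close>

lemma finite_\<Omega> [simp]: "finite \<Omega>"
  by (simp add: spin_configs_def finite_PiE)

lemma \<Omega>_nonempty: "\<Omega> \<noteq> {}"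
  by (simp add: spin_configs_def PiE_eq_empty_iff)

lemma \<Omega>_upd:
  assumes "x \<in> \<Omega>" "i \<in> {1..n}"
  shows "x(i := 1) \<in> \<Omega>" "x(i := -1) \<in> \<Omega>"
  using assms by (auto simp: spin_configs_def PiE_iff extensional_def)

lemma \<Omega>_val: "x \<in> \<Omega> \<Longrightarrow> i \<in> {1..n} \<Longrightarrow> x i = 1 \<or> x i = -1"
  by (auto simp: spin_configs_def PiE_iff)

lemma \<Omega>_val_square: "x \<in> \<Omega> \<Longrightarrow> i \<in> {1..n} \<Longrightarrow> x i * x i = 1"
  using \<Omega>_val[of x i] by auto

lemma weight_pos: "0 < ising_weight n A h x"
  by (simp add: ising_weight_def)

lemma partition_pos: "0 < (\<Sum>y\<in>\<Omega>. ising_weight n A h y)"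
  using \<Omega>_nonempty by (intro sum_pos weight_pos) auto

lemma gibbs_nonneg: "0 \<le> gibbs x"
  using weight_pos[of x] partition_pos by (simp add: gibbs_def)

lemma gibbs_sum: "(\<Sum>x\<in>\<Omega>. gibbs x) = 1"
  using partition_pos by (simp add: gibbs_def flip: sum_divide_distrib)

lemma ex_const [simp]: "ex (\<lambda>x. c) = c"
  by (simp add: ex_def gibbs_sum flip: sum_distrib_right)

lemma ex_add: "ex (\<lambda>x. f x + g x) = ex f + ex g"
  by (simp add: ex_def algebra_simps sum.distrib)

lemma ex_diff: "ex (\<lambda>x. f x - g x) = ex f - ex g"
  by (simp add: ex_def algebra_simps sum_subtractf)

lemma ex_cmult: "ex (\<lambda>x. c * f x) = c * ex f"
  by (simp add: ex_def sum_distrib_left algebra_simps)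

lemma ex_sum: "ex (\<lambda>x. \<Sum>i\<in>I. f i x) = (\<Sum>i\<in>I. ex (f i))"
  by (simp add: ex_def sum_distrib_left) (rule sum.swap)

lemma ex_mono: "(\<And>x. x \<in> \<Omega> \<Longrightarrow> f x \<le> g x) \<Longrightarrow> ex f \<le> ex g"
  by (auto simp: ex_def intro!: sum_mono mult_left_mono gibbs_nonneg)

lemma ex_cong: "(\<And>x. x \<in> \<Omega> \<Longrightarrow> f x = g x) \<Longrightarrow> ex f = ex g"
  by (simp add: ex_def)

lemma ex_abs_le: "(\<And>x. x \<in> \<Omega> \<Longrightarrow> \<bar>f x\<bar> \<le> c) \<Longrightarrow> \<bar>ex f\<bar> \<le> c"
  using ex_mono[of f "\<lambda>_. c"] ex_mono[of "\<lambda>_. -c" f] by (auto simp: abs_le_iff minus_le_iff)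

section \<open>Dependence of the conditional laws on single spins\<close>

lemma local_field_upd:
  assumes "j \<in> {1..n}" "j \<noteq> i"
  shows "local_field i (x(j := a)) = local_field i x + A i j * (a - x j)"
  unfolding local_field_def using assms
  by (subst (1 2) sum.remove[of _ j]) (auto simp: algebra_simps intro!: sum.cong)

lemma local_field_upd_self [simp]: "local_field i (x(i := a)) = local_field i x"
  unfolding local_field_def by (auto intro!: sum.cong)

lemma plus_prob_upd_self [simp]: "plus_prob i (x(i := a)) = plus_prob i x"
  by (simp add: plus_prob_def)

lemma cond_var_upd_self [simp]: "cond_var i (x(i := a)) = cond_var i x"
  by (simp add: cond_var_def)

lemma plus_prob_bounds: "0 \<le> plus_prob i x" "plus_prob i x \<le> 1"
  using tanh_real_bounds[of "local_field i x"] by (auto simp: plus_prob_def)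

lemma cond_var_bounds: "0 \<le> cond_var i x" "cond_var i x \<le> 1 / 4"
proof -
  show "0 \<le> cond_var i x" using plus_prob_bounds[of i x] by (simp add: cond_var_def)
  have "0 \<le> (plus_prob i x - 1 / 2)\<^sup>2" by simp
  then show "cond_var i x \<le> 1 / 4"
    by (simp add: cond_var_def power2_eq_square algebra_simps)
qed

text \<open>Switching spin \<open>j\<close> moves the local field by \<open>2 * A i j\<close>, tanh
  is 1-Lipschitz, and \<open>plus_prob\<close> halves it. The lower bound is where ferromagnetism
  enters: influences are nonnegative.\<close>

lemma spin_diff_plus_prob_bounds:
  assumes "i \<in> {1..n}" "j \<in> {1..n}" "i \<noteq> j"
  shows "0 \<le> spin_diff j (plus_prob i) x" "spin_diff j (plus_prob i) x \<le> A i j"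
proof -
  have A: "0 \<le> A i j" using A_nonneg assms by simp
  let ?a = "local_field i (x(j := 1))" and ?b = "local_field i (x(j := -1))"
  have ab: "?a - ?b = 2 * A i j"
    using assms by (simp add: local_field_upd algebra_simps)
  then have "tanh ?b \<le> tanh ?a" using A by simp
  moreover have "\<bar>tanh ?a - tanh ?b\<bar> \<le> 2 * A i j"
    using tanh_lipschitz[of ?a ?b] ab A by simp
  ultimately show "0 \<le> spin_diff j (plus_prob i) x" "spin_diff j (plus_prob i) x \<le> A i j"
    by (auto simp: spin_diff_def plus_prob_def simp flip: diff_divide_distrib)
qed

lemma spin_diff_cond_var_le:
  assumes "i \<in> {1..n}" "j \<in> {1..n}" "i \<noteq> j"
  shows "\<bar>spin_diff j (cond_var i) x\<bar> \<le> A i j"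
proof -
  let ?a = "plus_prob i (x(j := 1))" and ?b = "plus_prob i (x(j := -1))"
  have "spin_diff j (cond_var i) x = (?a - ?b) * (1 - ?a - ?b)"
    by (simp add: spin_diff_def cond_var_def algebra_simps)
  moreover have "\<bar>1 - ?a - ?b\<bar> \<le> 1"
    using plus_prob_bounds[of i "x(j := 1)"] plus_prob_bounds[of i "x(j := -1)"] by auto
  moreover have "\<bar>?a - ?b\<bar> \<le> A i j"
    using spin_diff_plus_prob_bounds[OF assms, of x] by (simp add: spin_diff_def)
  ultimately have "\<bar>spin_diff j (cond_var i) x\<bar> \<le> A i j * 1"
    using A_nonneg[OF assms] by (auto simp only: abs_mult intro!: mult_mono)
  then show ?thesis by simp
qed

text \<open>The four local fields involved are \<open>s\<close>, \<open>s\<close> plus either of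
  \<open>2 * A i j\<close> and \<open>2 * A i k\<close>, and \<open>s\<close> plus both, so this is
  half a second difference of tanh.\<close>

lemma spin_diff2_plus_prob_le:
  assumes "i \<in> {1..n}" "j \<in> {1..n}" "k \<in> {1..n}" "i \<noteq> j" "i \<noteq> k" "j \<noteq> k"
  shows "\<bar>spin_diff k (spin_diff j (plus_prob i)) x\<bar> \<le> 4 * A i j * A i k"
proof -
  let ?s = "local_field i (x(k := -1, j := -1))"
  have "local_field i (x(k := -1, j := 1)) = ?s + 2 * A i j"
    "local_field i (x(k := 1, j := -1)) = ?s + 2 * A i k"
    "local_field i (x(k := 1, j := 1)) = ?s + 2 * A i j + 2 * A i k"
    using assms by (simp_all add: local_field_upd algebra_simps)
  then have "spin_diff k (spin_diff j (plus_prob i)) x =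
     ((tanh (?s + 2 * A i j + 2 * A i k) - tanh (?s + 2 * A i j)) - (tanh (?s + 2 * A i k) - tanh ?s)) / 2"
    by (simp add: spin_diff_def plus_prob_def field_simps)
  also have "\<bar>\<dots>\<bar> \<le> 2 * \<bar>2 * A i j\<bar> * \<bar>2 * A i k\<bar> / 2"
    using tanh_second_difference[of ?s "2 * A i j" "2 * A i k"] by simp
  also have "\<dots> = 4 * A i j * A i k"
    using assms A_nonneg by simp
  finally show ?thesis .
qed

section \<open>Reversibility and the Dirichlet form\<close>

lemma weight_ratio:
  assumes "i \<in> {1..n}"
  shows "ising_weight n A h (x(i := 1)) = exp (2 * local_field i x) * ising_weight n A h (x(i := -1))"
proof -
  let ?V = "{1..n}"
  \<comment> \<open>The exponent is split by its dependence on the spin value \<open>a\<close> at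
    site \<open>i\<close>. The diagonal term carries \<open>a * a\<close>, equal for both signs; row
    and column \<open>i\<close> agree by symmetry, and their factor 2 cancels the division by 2 in
    the weight.\<close>
  have quad: "(\<Sum>j\<in>?V. \<Sum>k\<in>?V. (x(i := a)) j * A j k * (x(i := a)) k) =
      a * a * A i i + 2 * a * (\<Sum>j\<in>?V - {i}. A i j * x j)
      + (\<Sum>j\<in>?V - {i}. \<Sum>k\<in>?V - {i}. x j * A j k * x k)" for a
  proof -
    have inner: "(\<Sum>k\<in>?V. (x(i := a)) j * A j k * (x(i := a)) k) =
        (x(i := a)) j * A j i * a + (\<Sum>k\<in>?V - {i}. (x(i := a)) j * A j k * x k)" for j
      using assms by (subst sum.remove[of _ i]) auto
    have "(\<Sum>j\<in>?V. \<Sum>k\<in>?V. (x(i := a)) j * A j k * (x(i := a)) k) =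
      (a * A i i * a + (\<Sum>k\<in>?V - {i}. a * A i k * x k))
      + (\<Sum>j\<in>?V - {i}. x j * A j i * a + (\<Sum>k\<in>?V - {i}. x j * A j k * x k))"
      unfolding inner using assms by (subst sum.remove[of _ i]) auto
    also have "(\<Sum>k\<in>?V - {i}. a * A i k * x k) = a * (\<Sum>j\<in>?V - {i}. A i j * x j)"
      by (simp add: sum_distrib_left algebra_simps)
    also have "(\<Sum>j\<in>?V - {i}. x j * A j i * a + (\<Sum>k\<in>?V - {i}. x j * A j k * x k)) =
       a * (\<Sum>j\<in>?V - {i}. A i j * x j) + (\<Sum>j\<in>?V - {i}. \<Sum>k\<in>?V - {i}. x j * A j k * x k)"
      using A_sym assms by (auto simp: sum.distrib sum_distrib_left algebra_simps intro!: sum.cong)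
    finally show ?thesis by (simp add: algebra_simps)
  qed
  have lin: "(\<Sum>j\<in>?V. h j * (x(i := a)) j) = h i * a + (\<Sum>j\<in>?V - {i}. h j * x j)" for a
    using assms by (subst sum.remove[of _ i]) auto
  show ?thesis
    unfolding ising_weight_def quad lin local_field_def by (simp add: field_simps flip: exp_add)
qed

lemma plus_prob_alt: "plus_prob i x = exp (2 * local_field i x) / (1 + exp (2 * local_field i x))"
proof -
  define E where "E = exp (2 * local_field i x)"
  have "E > 0" by (simp add: E_def)
  have "tanh (local_field i x) = (1 - inverse E) / (1 + inverse E)"
    by (simp add: tanh_real_altdef E_def exp_minus)
  also have "\<dots> = (E - 1) / (E + 1)"
    using \<open>E > 0\<close> by (simp add: divide_simps)
  finally show ?thesis
    using \<open>E > 0\<close> by (simp add: plus_prob_def flip: E_def) (simp add: field_simps)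
qed

lemma detailed_balance:
  assumes "i \<in> {1..n}"
  shows "gibbs (x(i := 1)) = plus_prob i x * (gibbs (x(i := 1)) + gibbs (x(i := -1)))"
    and "gibbs (x(i := -1)) = (1 - plus_prob i x) * (gibbs (x(i := 1)) + gibbs (x(i := -1)))"
proof -
  have pos: "1 + exp (2 * local_field i x) > 0" by (simp add: add_pos_pos)
  have g: "gibbs (x(i := 1)) = exp (2 * local_field i x) * gibbs (x(i := -1))"
    by (simp add: gibbs_def weight_ratio[OF assms])
  show *: "gibbs (x(i := 1)) = plus_prob i x * (gibbs (x(i := 1)) + gibbs (x(i := -1)))"
    unfolding g plus_prob_alt using pos by (simp add: field_simps)
  then show "gibbs (x(i := -1)) = (1 - plus_prob i x) * (gibbs (x(i := 1)) + gibbs (x(i := -1)))"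
    by (simp add: algebra_simps)
qed

text \<open>Flipping spin \<open>i\<close> is an involution of the configurations, and the
  right-hand sum counts each pair twice. Identities between sums thus reduce to identities on
  two-point fibres.\<close>

lemma sum_\<Omega>_pair:
  assumes "i \<in> {1..n}"
  shows "(\<Sum>x\<in>\<Omega>. k x) = (\<Sum>x\<in>\<Omega>. (k (x(i := 1)) + k (x(i := -1)))) / (2::real)"
proof -
  let ?flip = "\<lambda>x::nat \<Rightarrow> real. x(i := - x i)"
  have flip: "?flip x \<in> \<Omega>" if "x \<in> \<Omega>" for x
    using \<Omega>_val[OF that assms] \<Omega>_upd[OF that assms] by auto
  have "(\<Sum>x\<in>\<Omega>. k x) = (\<Sum>x\<in>\<Omega>. k (?flip x))"
    by (rule sum.reindex_bij_witness[of _ ?flip ?flip]) (auto simp: flip)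
  then have "2 * (\<Sum>x\<in>\<Omega>. k x) = (\<Sum>x\<in>\<Omega>. k x + k (?flip x))"
    by (simp add: sum.distrib)
  also have "\<dots> = (\<Sum>x\<in>\<Omega>. k (x(i := 1)) + k (x(i := -1)))"
  proof (rule sum.cong)
    fix x assume x: "x \<in> \<Omega>"
    from \<Omega>_val[OF x assms] show "k x + k (?flip x) = k (x(i := 1)) + k (x(i := -1))"
    proof
      assume "x i = 1"
      then have "x(i := 1) = x" by auto
      with \<open>x i = 1\<close> show ?thesis by simp
    next
      assume "x i = -1"
      then have "x(i := -1) = x" by auto
      with \<open>x i = -1\<close> show ?thesis by simp
    qed
  qed simp
  finally show ?thesis by simp
qed

text \<open>On a fibre of site \<open>i\<close> of total mass \<open>w\<close>, with
  \<open>p\<close> the conditional probability of 1, the generator term equals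
  \<open>- (1 - p)\<close> times the difference of \<open>f\<close> at 1 and \<open>p\<close> times
  it at -1. The masses \<open>p * w\<close> and \<open>(1 - p) * w\<close> make both coefficients
  \<open>p * (1 - p) * w\<close> up to sign, leaving the difference of \<open>g\<close>.\<close>

lemma dirichlet_form:
  "ex (\<lambda>x. glauber f x * g x) = - (\<Sum>i=1..n. ex (\<lambda>x. cond_var i x * spin_diff i f x * spin_diff i g x))"
proof -
  let ?t = "\<lambda>i x. plus_prob i x * f (x(i := 1)) + (1 - plus_prob i x) * f (x(i := -1)) - f x"
  have "ex (\<lambda>x. ?t i x * g x) = - ex (\<lambda>x. cond_var i x * spin_diff i f x * spin_diff i g x)"
    if i: "i \<in> {1..n}" for i
  proof -
    have "gibbs (x(i := 1)) * (?t i (x(i := 1)) * g (x(i := 1)))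
        + gibbs (x(i := -1)) * (?t i (x(i := -1)) * g (x(i := -1)))
      = - (gibbs (x(i := 1)) * (cond_var i x * spin_diff i f x * spin_diff i g x)
        + gibbs (x(i := -1)) * (cond_var i x * spin_diff i f x * spin_diff i g x))" (is "?l = ?r") for x
    proof -
      define w where "w = gibbs (x(i := 1)) + gibbs (x(i := -1))"
      have w: "gibbs (x(i := 1)) = plus_prob i x * w" "gibbs (x(i := -1)) = (1 - plus_prob i x) * w"
        using detailed_balance[OF i, of x] by (simp_all add: w_def)
      show ?thesis unfolding w
        by (simp add: spin_diff_def cond_var_def algebra_simps)
    qed
    then show ?thesis
      unfolding ex_def by (subst (1 2) sum_\<Omega>_pair[OF i]) (simp flip: sum_negf)
  qed
  then show ?thesis
    by (simp add: glauber_def flip_gen_def sum_distrib_right ex_sum sum_negf)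
qed

lemma ex_glauber: "ex (glauber f) = 0"
  using dirichlet_form[of f "\<lambda>_. 1"] by (simp add: spin_diff_def)

subsection \<open>The Poisson equation\<close>

lemma spin_diff_glauber:
  assumes "j \<in> {1..n}"
  shows "spin_diff j (glauber F) x =
    flip_gen ({1..n} - {j}) (\<lambda>i y. plus_prob i (y(j := 1))) (spin_diff j F) x
    + (\<Sum>i\<in>{1..n} - {j}. spin_diff j (plus_prob i) x * spin_diff i F (x(j := -1)))
    - spin_diff j F x"
  unfolding glauber_def using assms by (subst spin_diff_flip_gen) auto

lemma sum_A_le: "j \<in> {1..n} \<Longrightarrow> (\<Sum>i\<in>{1..n} - {j}. A i j) \<le> \<alpha>"
  using row_sum[of j] by (subst sum.cong[OF refl, of _ _ "A j"]) (auto simp: A_sym)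

text \<open>The total influence of spin \<open>j\<close> on the others is at most a column sum of
  \<open>A\<close>, which is a row sum by symmetry.\<close>

lemma sum_influence_le:
  assumes "j \<in> {1..n}" and "\<And>i. i \<in> {1..n} \<Longrightarrow> \<bar>w i\<bar> \<le> M" "0 \<le> M"
  shows "\<bar>\<Sum>i\<in>{1..n} - {j}. spin_diff j (plus_prob i) x * w i\<bar> \<le> \<alpha> * M"
proof -
  have "\<bar>\<Sum>i\<in>{1..n} - {j}. spin_diff j (plus_prob i) x * w i\<bar> \<le> (\<Sum>i\<in>{1..n} - {j}. A i j * M)"
  proof (rule order_trans[OF sum_abs sum_mono])
    fix i assume i: "i \<in> {1..n} - {j}"
    then show "\<bar>spin_diff j (plus_prob i) x * w i\<bar> \<le> A i j * M"
      unfolding abs_mult using spin_diff_plus_prob_bounds[of i j x] assms A_nonneg[of i j]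
      by (intro mult_mono) auto
  qed
  also have "\<dots> \<le> \<alpha> * M"
    using sum_A_le[OF assms(1)] assms(3) by (simp add: mult_right_mono flip: sum_distrib_right)
  finally show ?thesis .
qed

text \<open>\<open>y\<close> is turned into \<open>x\<close> one site at a time, each change costing
  at most \<open>M\<close>. The induction is over a set of sites outside which the two
  agree.\<close>

lemma oscillation_le:
  fixes M :: real
  assumes g: "\<And>j z. j \<in> {1..n} \<Longrightarrow> z \<in> \<Omega> \<Longrightarrow> \<bar>spin_diff j g z\<bar> \<le> M"
    and "0 \<le> M" "x \<in> \<Omega>" "y \<in> \<Omega>"
  shows "\<bar>g x - g y\<bar> \<le> n * M"
proof -
  have "\<bar>g x - g y\<bar> \<le> card B * M"
    if "finite B" "B \<subseteq> {1..n}" "y \<in> \<Omega>" "\<And>i. i \<notin> B \<Longrightarrow> x i = y i" for B y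
    using that
  proof (induction B arbitrary: y rule: finite_induct)
    case empty
    then have "x = y" by auto
    then show ?case by simp
  next
    case (insert j B)
    let ?y = "y(j := x j)"
    have j: "j \<in> {1..n}" using insert by auto
    have y: "?y \<in> \<Omega>"
      using \<Omega>_val[OF \<open>x \<in> \<Omega>\<close> j] \<Omega>_upd[OF \<open>y \<in> \<Omega>\<close> j] by auto
    have "\<bar>g x - g ?y\<bar> \<le> card B * M"
      using insert.prems by (intro insert.IH[OF _ y]) auto
    moreover have "\<bar>g ?y - g y\<bar> \<le> M"
    proof -
      have "g ?y - g y = g (y(j := x j)) - g (y(j := y j))" by simp
      then show ?thesis
        using \<Omega>_val[OF \<open>x \<in> \<Omega>\<close> j] \<Omega>_val[OF \<open>y \<in> \<Omega>\<close> j] g[OF j \<open>y \<in> \<Omega>\<close>] \<open>0 \<le> M\<close>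
        by (auto simp: spin_diff_def simp del: fun_upd_triv)
    qed
    ultimately show ?case
      using insert.hyps by (simp add: algebra_simps)
  qed
  from this[of "{1..n}" y] show ?thesis
    using assms by (auto simp: spin_configs_def PiE_iff extensional_def)
qed

text \<open>\<open>g + glauber g / n\<close> is one step of the chain that resamples a uniformly
  chosen site. In its difference at \<open>j\<close>, the \<open>n - 1\<close> other sites
  contribute averages bounded by \<open>M\<close>, site \<open>j\<close> contributes nothing since
  resampling erases its spin, and the influences add at most \<open>\<alpha> * M\<close>.\<close>

lemma spin_diff_contraction:
  assumes g: "\<And>j z. j \<in> {1..n} \<Longrightarrow> z \<in> \<Omega> \<Longrightarrow> \<bar>spin_diff j g z\<bar> \<le> M"
    and "0 \<le> M" "j \<in> {1..n}" "x \<in> \<Omega>"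
  shows "\<bar>spin_diff j (\<lambda>x. g x + glauber g x / n) x\<bar> \<le> (1 - (1 - \<alpha>) / n) * M"
proof -
  let ?V = "{1..n} - {j}"
  let ?q = "\<lambda>i. plus_prob i (x(j := 1))" and ?u = "spin_diff j g"
  let ?a = "\<lambda>i. ?q i * ?u (x(i := 1)) + (1 - ?q i) * ?u (x(i := -1))"
  let ?r = "\<Sum>i\<in>?V. spin_diff j (plus_prob i) x * spin_diff i g (x(j := -1))"
  have avg: "\<bar>\<Sum>i\<in>?V. ?a i\<bar> \<le> (\<Sum>i\<in>?V. M)"
  proof (rule order_trans[OF sum_abs sum_mono])
    fix i assume i: "i \<in> ?V"
    have "\<bar>?a i\<bar> \<le> ?q i * \<bar>?u (x(i := 1))\<bar> + (1 - ?q i) * \<bar>?u (x(i := -1))\<bar>"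
      using plus_prob_bounds by (intro order_trans[OF abs_triangle_ineq]) (simp add: abs_mult)
    also have "\<dots> \<le> ?q i * M + (1 - ?q i) * M"
      using i assms \<Omega>_upd plus_prob_bounds by (intro add_mono mult_left_mono) auto
    finally show "\<bar>?a i\<bar> \<le> M" by (simp add: algebra_simps)
  qed
  have card: "real (card ?V) = real n - 1"
    using assms n_pos by (simp add: card_Diff_singleton of_nat_diff del: card_Diff_insert)
  have r: "\<bar>?r\<bar> \<le> \<alpha> * M"
    using assms \<Omega>_upd by (intro sum_influence_le) auto
  have "flip_gen ?V (\<lambda>i y. plus_prob i (y(j := 1))) ?u x = (\<Sum>i\<in>?V. ?a i) - (real n - 1) * ?u x"
    unfolding flip_gen_def sum_subtractf sum_constant card by simp
  then have "spin_diff j (glauber g) x = (\<Sum>i\<in>?V. ?a i) + ?r - n * ?u x"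
    by (simp add: spin_diff_glauber[OF assms(3)] algebra_simps)
  moreover have "spin_diff j (\<lambda>x. g x + glauber g x / n) x = ?u x + spin_diff j (glauber g) x / n"
    by (simp add: spin_diff_def diff_divide_distrib)
  ultimately have eq: "spin_diff j (\<lambda>x. g x + glauber g x / n) x = ((\<Sum>i\<in>?V. ?a i) + ?r) / n"
    using n_pos by (simp add: field_simps)
  have "\<bar>(\<Sum>i\<in>?V. ?a i) + ?r\<bar> \<le> (real n - 1) * M + \<alpha> * M"
    using avg r unfolding sum_constant card by linarith
  also have "\<dots> = (1 - (1 - \<alpha>) / n) * M * n"
    using n_pos by (simp add: field_simps)
  finally show ?thesis
    unfolding eq using n_pos by (simp add: pos_divide_le_eq)
qed

text \<open>With \<open>g k\<close> the image of the centred \<open>f\<close> after \<open>k\<close>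
  steps of the discrete chain, \<open>F\<close> is the sum of \<open>g k / n\<close>. The generator
  sends \<open>g k / n\<close> to \<open>g (Suc k) - g k\<close>, so the series telescopes; it
  converges because differences contract geometrically and the mean stays 0.\<close>

theorem poisson_equation: "\<exists>F. \<forall>x\<in>\<Omega>. glauber F x = ex f - f x"
proof -
  define g where "g = rec_nat (\<lambda>x. f x - ex f) (\<lambda>_ g x. g x + glauber g x / n)"
  have g0: "g 0 = (\<lambda>x. f x - ex f)" and gS: "g (Suc k) = (\<lambda>x. g k x + glauber (g k) x / n)" for k
    by (simp_all add: g_def)
  have ex_g: "ex (g k) = 0" for k
  proof (induction k)
    case 0
    then show ?case by (simp add: g0 ex_diff)
  next
    case (Suc k)
    then show ?case
      using ex_cmult[of "1 / n" "glauber (g k)"] by (simp add: gS ex_add ex_glauber)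
  qed
  define \<rho> where "\<rho> = 1 - (1 - \<alpha>) / n"
  have \<rho>: "0 \<le> \<rho>" "\<rho> < 1"
    using n_pos \<alpha>_nonneg \<alpha>_less_1 by (auto simp: \<rho>_def field_simps)
  define M where "M = Max ((\<lambda>(j, x). \<bar>spin_diff j (g 0) x\<bar>) ` ({1..n} \<times> \<Omega>))"
  have M: "\<bar>spin_diff j (g 0) x\<bar> \<le> M" if "j \<in> {1..n}" "x \<in> \<Omega>" for j x
    unfolding M_def using that by (intro Max_ge) (auto intro!: image_eqI[of _ _ "(j, x)"])
  obtain y where y: "y \<in> \<Omega>" using \<Omega>_nonempty by auto
  have M0: "0 \<le> M" using M[of 1 y] n_pos y by simp
  have dg: "\<bar>spin_diff j (g k) x\<bar> \<le> \<rho> ^ k * M" if "j \<in> {1..n}" "x \<in> \<Omega>" for j x k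
    using that
  proof (induction k arbitrary: j x)
    case (Suc k)
    then show ?case
      unfolding gS using spin_diff_contraction[of "g k" "\<rho> ^ k * M" j x] M0 \<rho>
      by (simp add: \<rho>_def algebra_simps)
  qed (use M in simp)
  \<comment> \<open>Since \<open>g k\<close> has mean 0, its value at \<open>x\<close> is the mean
    of \<open>g k x - g k y\<close> over \<open>y\<close>, hence at most the oscillation.\<close>
  have bound: "\<bar>g k x\<bar> \<le> \<rho> ^ k * (n * M)" if "x \<in> \<Omega>" for k x
  proof -
    have "\<bar>ex (\<lambda>y. g k x - g k y)\<bar> \<le> n * (\<rho> ^ k * M)"
      using that dg M0 \<rho> by (intro ex_abs_le oscillation_le) auto
    then show ?thesis by (simp add: ex_diff ex_g algebra_simps)
  qed
  have summ: "summable (\<lambda>k. g k x)" if "x \<in> \<Omega>" for x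
    by (rule summable_comparison_test'[of "\<lambda>k. \<rho> ^ k * (n * M)" 0])
      (use bound that \<rho> in \<open>auto intro!: summable_mult2 summable_geometric\<close>)
  define F where "F x = (\<Sum>k. g k x) / n" for x
  have F: "(\<lambda>k. g k x / n) sums F x" if "x \<in> \<Omega>" for x
    unfolding F_def using summ[OF that] by (intro sums_divide summable_sums)
  have "glauber F x = ex f - f x" if x: "x \<in> \<Omega>" for x
  proof -
    \<comment> \<open>\<open>glauber\<close> is a finite linear combination of point evaluations, so
      it passes through the series.\<close>
    have "(\<lambda>k. glauber (\<lambda>x. g k x / n) x) sums glauber F x"
      unfolding glauber_def flip_gen_def
      by (intro sums_sum sums_add sums_diff sums_mult F) (use x \<Omega>_upd in auto)
    moreover have "glauber (\<lambda>x. g k x / n) x = g (Suc k) x - g k x" for k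
      unfolding gS by (simp add: glauber_def flip_gen_def sum_divide_distrib diff_divide_distrib add_divide_distrib)
    moreover have "(\<lambda>k. g (Suc k) x - g k x) sums (0 - g 0 x)"
      using summable_LIMSEQ_zero[OF summ[OF x]] by (rule telescope_sums)
    ultimately have "glauber F x = 0 - g 0 x"
      using sums_unique2 by simp
    then show ?thesis by (simp add: g0)
  qed
  then show ?thesis by blast
qed

section \<open>First differences of solutions of the Poisson equation\<close>

lemma spin_diff_poisson_eq:
  assumes F: "\<And>x. x \<in> \<Omega> \<Longrightarrow> glauber F x = ex f - f x" and "j \<in> {1..n}" "x \<in> \<Omega>"
  shows "1 * spin_diff j F x =
    (spin_diff j f x + (\<Sum>i\<in>{1..n} - {j}. spin_diff j (plus_prob i) x * spin_diff i F (x(j := -1))))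
    + flip_gen ({1..n} - {j}) (\<lambda>i y. plus_prob i (y(j := 1))) (spin_diff j F) x"
proof -
  have "spin_diff j (glauber F) x = - spin_diff j f x"
    using F \<Omega>_upd[OF assms(3,2)] by (simp add: spin_diff_def)
  then show ?thesis
    by (simp add: spin_diff_glauber[OF assms(2)])
qed

text \<open>Killing at rate 1 gives coefficient 1 on the left of the differenced equation. If
  \<open>M\<close> is the largest absolute first difference, the source is at most
  \<open>B + \<alpha> * M\<close>; the maximum principle for a component attaining \<open>M\<close>
  gives \<open>M \<le> B + \<alpha> * M\<close>.\<close>

lemma spin_diff_poisson_le:
  assumes F: "\<And>x. x \<in> \<Omega> \<Longrightarrow> glauber F x = ex f - f x"
    and f: "\<And>j x. j \<in> {1..n} \<Longrightarrow> x \<in> \<Omega> \<Longrightarrow> \<bar>spin_diff j f x\<bar> \<le> B"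
    and "j \<in> {1..n}" "x \<in> \<Omega>"
  shows "\<bar>spin_diff j F x\<bar> \<le> B / (1 - \<alpha>)"
proof -
  let ?D = "(\<lambda>(j, x). \<bar>spin_diff j F x\<bar>) ` ({1..n} \<times> \<Omega>)"
  define M where "M = Max ?D"
  have M: "\<bar>spin_diff j F x\<bar> \<le> M" if "j \<in> {1..n}" "x \<in> \<Omega>" for j x
    unfolding M_def using that by (intro Max_ge) (auto intro!: image_eqI[of _ _ "(j, x)"])
  have M0: "0 \<le> M" using M[OF assms(3,4)] by simp
  have "M \<in> ?D"
    unfolding M_def using n_pos \<Omega>_nonempty by (intro Max_in) auto
  then obtain k y where k: "k \<in> {1..n}" "y \<in> \<Omega>" "M = \<bar>spin_diff k F y\<bar>" by auto
  have "1 * \<bar>spin_diff k F y\<bar> \<le> B + \<alpha> * M"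
  proof (rule flip_gen_abs_max_principle[OF _ finite_\<Omega> _ _ spin_diff_poisson_eq[OF F k(1)] _ _ k(2)])
    fix z assume z: "z \<in> \<Omega>"
    then have "\<bar>\<Sum>i\<in>{1..n} - {k}. spin_diff k (plus_prob i) z * spin_diff i F (z(k := -1))\<bar> \<le> \<alpha> * M"
      using k M M0 \<Omega>_upd by (intro sum_influence_le) auto
    then show "\<bar>spin_diff k f z + (\<Sum>i\<in>{1..n} - {k}. spin_diff k (plus_prob i) z * spin_diff i F (z(k := -1)))\<bar>
        \<le> B + \<alpha> * M"
      using f[OF k(1) z] by linarith
  qed (use \<Omega>_upd plus_prob_bounds in auto)
  then have "(1 - \<alpha>) * M \<le> B" using k(3) by (simp add: algebra_simps)
  then have "M \<le> B / (1 - \<alpha>)" using \<alpha>_less_1 by (simp add: field_simps)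
  then show ?thesis using M[OF assms(3,4)] by simp
qed

text \<open>The same argument from below, with the least first difference \<open>m\<close>. As
  influences are nonnegative, a negative \<open>m\<close> would satisfy
  \<open>m \<ge> B + \<alpha> * m\<close>, impossible for \<open>\<alpha> < 1\<close> and
  \<open>0 \<le> B\<close>. Hence the influence term is nonnegative and the source is at least
  \<open>B\<close>.\<close>

lemma spin_diff_poisson_ge:
  assumes F: "\<And>x. x \<in> \<Omega> \<Longrightarrow> glauber F x = ex f - f x"
    and f: "\<And>j x. j \<in> {1..n} \<Longrightarrow> x \<in> \<Omega> \<Longrightarrow> B \<le> spin_diff j f x" "0 \<le> B"
    and "j \<in> {1..n}" "x \<in> \<Omega>"
  shows "B \<le> spin_diff j F x"
proof -
  let ?D = "(\<lambda>(j, x). spin_diff j F x) ` ({1..n} \<times> \<Omega>)"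
  define m where "m = Min ?D"
  have m: "m \<le> spin_diff j F x" if "j \<in> {1..n}" "x \<in> \<Omega>" for j x
    unfolding m_def using that by (intro Min_le) (auto intro!: image_eqI[of _ _ "(j, x)"])
  have "m \<in> ?D"
    unfolding m_def using n_pos \<Omega>_nonempty by (intro Min_in) auto
  then obtain k y where k: "k \<in> {1..n}" "y \<in> \<Omega>" "m = spin_diff k F y" by auto
  \<comment> \<open>Truncation to \<open>min m 0\<close> makes the bound nonpositive, so enlarging
    the influences to \<open>A i j\<close> and the column sum to \<open>\<alpha>\<close> only lowers
    it. The maximum principle is applied to the negated difference.\<close>
  have lower: "B + \<alpha> * min m 0 \<le> spin_diff j F x" if j: "j \<in> {1..n}" and x: "x \<in> \<Omega>" for j x
  proof -
    let ?r = "\<lambda>x. spin_diff j f x + (\<Sum>i\<in>{1..n} - {j}. spin_diff j (plus_prob i) x * spin_diff i F (x(j := -1)))"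
    have "1 * (- spin_diff j F x) \<le> - (B + \<alpha> * min m 0)"
    proof (rule flip_gen_max_principle[where u = "\<lambda>x. - spin_diff j F x" and r = "\<lambda>x. - ?r x" and \<Omega> = \<Omega>
          and I = "{1..n} - {j}" and q = "\<lambda>i y. plus_prob i (y(j := 1))"])
      fix z assume z: "z \<in> \<Omega>"
      show "1 * - spin_diff j F z = - ?r z +
          flip_gen ({1..n} - {j}) (\<lambda>i y. plus_prob i (y(j := 1))) (\<lambda>x. - spin_diff j F x) z"
        using spin_diff_poisson_eq[OF F j z] unfolding flip_gen_uminus by linarith
      have "\<alpha> * min m 0 \<le> (\<Sum>i\<in>{1..n} - {j}. A i j) * min m 0"
        using sum_A_le[OF j] by (intro mult_right_mono_neg) auto
      also have "\<dots> = (\<Sum>i\<in>{1..n} - {j}. A i j * min m 0)" by (simp add: sum_distrib_right)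
      also have "\<dots> \<le> (\<Sum>i\<in>{1..n} - {j}. spin_diff j (plus_prob i) z * spin_diff i F (z(j := -1)))"
      proof (rule sum_mono)
        fix i assume i: "i \<in> {1..n} - {j}"
        note b = spin_diff_plus_prob_bounds[of i j z]
        have "A i j * min m 0 \<le> spin_diff j (plus_prob i) z * min m 0"
          using b i j by (intro mult_right_mono_neg) auto
        also have "\<dots> \<le> spin_diff j (plus_prob i) z * spin_diff i F (z(j := -1))"
          using b i j m[of i "z(j := -1)"] \<Omega>_upd[OF z j] by (intro mult_left_mono) auto
        finally show "A i j * min m 0 \<le> spin_diff j (plus_prob i) z * spin_diff i F (z(j := -1))" .
      qed
      finally show "- ?r z \<le> - (B + \<alpha> * min m 0)" using f(1)[OF j z] by simp
    qed (use x \<Omega>_upd plus_prob_bounds in auto)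
    then show ?thesis by simp
  qed
  have "0 \<le> m"
  proof (rule ccontr)
    assume "\<not> 0 \<le> m"
    moreover have "B + \<alpha> * min m 0 \<le> m" using lower[OF k(1,2)] k(3) by simp
    moreover have "1 * m < \<alpha> * m"
      using \<open>\<not> 0 \<le> m\<close> \<alpha>_less_1 by (intro mult_strict_right_mono_neg) auto
    ultimately show False using f(2) by auto
  qed
  then show ?thesis using lower[OF assms(4,5)] by simp
qed

subsection \<open>Second differences and Stein's identity\<close>

definition mag :: "(nat \<Rightarrow> real) \<Rightarrow> real" where
  "mag x = (\<Sum>i=1..n. x i)"

text \<open>Factor by which solving the Poisson equation enlarges bounds on first differences. The
  later estimates use numerical multiples of powers of \<open>K\<close>, hence are uniform in
  \<open>n\<close> and in the field.\<close>

definition K :: real where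
  "K = 1 / (1 - \<alpha>)"

lemma K_ge_1: "1 \<le> K"
  using \<alpha>_nonneg \<alpha>_less_1 by (simp add: K_def field_simps)

lemma mag_upd: "i \<in> {1..n} \<Longrightarrow> mag (x(i := a)) = mag x + a - x i"
  by (simp add: mag_def sum.remove[of _ i])

lemma spin_diff_mag: "i \<in> {1..n} \<Longrightarrow> spin_diff i mag x = 2"
  by (simp add: spin_diff_def mag_upd)

end

text \<open>Fixes one solution for the magnetization. \<open>poisson_equation\<close> supplies it
  whenever the locale is interpreted, so final statements are free of \<open>F\<close>.\<close>

locale mag_poisson = high_temp_ising +
  fixes F :: "(nat \<Rightarrow> real) \<Rightarrow> real"
  assumes F: "x \<in> \<Omega> \<Longrightarrow> glauber F x = ex mag - mag x"
begin

lemma spin_diff_F_ge: "j \<in> {1..n} \<Longrightarrow> x \<in> \<Omega> \<Longrightarrow> 2 \<le> spin_diff j F x"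
  using spin_diff_poisson_ge[OF F] spin_diff_mag by simp

lemma abs_spin_diff_F_le: "j \<in> {1..n} \<Longrightarrow> x \<in> \<Omega> \<Longrightarrow> \<bar>spin_diff j F x\<bar> \<le> 2 * K"
  using spin_diff_poisson_le[OF F, of 2] spin_diff_mag by (simp add: K_def)

text \<open>Sup norms of the mixed second differences; they turn the twice differenced equation into
  a linear inequality for a symmetric matrix.\<close>

definition U :: "nat \<Rightarrow> nat \<Rightarrow> real" where
  "U j k = Max ((\<lambda>x. \<bar>spin_diff k (spin_diff j F) x\<bar>) ` \<Omega>)"

lemma U_ge: "x \<in> \<Omega> \<Longrightarrow> \<bar>spin_diff k (spin_diff j F) x\<bar> \<le> U j k"
  unfolding U_def by (intro Max_ge) auto

lemma U_nonneg: "0 \<le> U j k"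
proof -
  obtain x where "x \<in> \<Omega>" using \<Omega>_nonempty by auto
  from U_ge[OF this, of k j] show ?thesis by simp
qed

lemma U_attained: obtains x where "x \<in> \<Omega>" "U j k = \<bar>spin_diff k (spin_diff j F) x\<bar>"
proof -
  have "U j k \<in> (\<lambda>x. \<bar>spin_diff k (spin_diff j F) x\<bar>) ` \<Omega>"
    unfolding U_def using \<Omega>_nonempty by (intro Max_in) auto
  then show ?thesis using that by auto
qed

lemma U_commute: "U j k = U k j"
  unfolding U_def by (subst spin_diff_commute) (rule refl)

text \<open>Differencing the Poisson equation in \<open>j\<close> and \<open>k\<close> kills at rate
  2, once for each erased spin, and the constant difference of \<open>mag\<close> drops out. The
  source at \<open>i\<close> has three parts: the second difference of the rate times a first
  difference of \<open>F\<close>, bounded by \<open>4 * A i j * A i k * (2 * K)\<close>, and two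
  products of one influence with a second difference of \<open>F\<close>.\<close>

lemma U_recursion:
  assumes j: "j \<in> {1..n}" and k: "k \<in> {1..n}" and "j \<noteq> k"
  shows "2 * U j k \<le>
    (\<Sum>i\<in>{1..n} - {j} - {k}. 8 * K * (A i j * A i k) + A i j * U i k + A i k * U i j)"
proof -
  let ?V = "{1..n} - {j}"
  let ?W = "{1..n} - {j} - {k}"
  let ?u = "spin_diff j F"
  let ?q = "\<lambda>i y. plus_prob i (y(j := 1))"
  let ?t = "\<lambda>i y. spin_diff j (plus_prob i) y * spin_diff i F (y(j := -1))"
  let ?r = "\<lambda>x. (\<Sum>i\<in>?V. spin_diff k (?t i) x) + (\<Sum>i\<in>?W. spin_diff k (?q i) x * spin_diff i ?u (x(k := -1)))"
  have kV: "k \<in> ?V" using k \<open>j \<noteq> k\<close> by auto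
  have eq: "2 * spin_diff k ?u x = ?r x + flip_gen ?W (\<lambda>i y. ?q i (y(k := 1))) (spin_diff k ?u) x"
    if x: "x \<in> \<Omega>" for x
  proof -
    have u: "?u y = (2 + (\<Sum>i\<in>?V. ?t i y)) + flip_gen ?V ?q ?u y" if "y \<in> \<Omega>" for y
      using spin_diff_poisson_eq[OF F j that] spin_diff_mag[OF j] by simp
    have "spin_diff k ?u x = (\<Sum>i\<in>?V. spin_diff k (?t i) x) + spin_diff k (flip_gen ?V ?q ?u) x"
      unfolding spin_diff_def[of k ?u] u[OF \<Omega>_upd(1)[OF x k]] u[OF \<Omega>_upd(2)[OF x k]]
      by (simp add: spin_diff_def[of k] sum_subtractf)
    also have "spin_diff k (flip_gen ?V ?q ?u) x =
        flip_gen ?W (\<lambda>i y. ?q i (y(k := 1))) (spin_diff k ?u) x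
        + (\<Sum>i\<in>?W. spin_diff k (?q i) x * spin_diff i ?u (x(k := -1))) - spin_diff k ?u x"
      using kV \<open>j \<noteq> k\<close> by (subst spin_diff_flip_gen) (auto simp: fun_upd_twist[of k j])
    finally show ?thesis by linarith
  qed
  have r: "\<bar>?r x\<bar> \<le> (\<Sum>i\<in>?W. 8 * K * (A i j * A i k) + A i j * U i k + A i k * U i j)" if x: "x \<in> \<Omega>" for x
  proof -
    \<comment> \<open>Neither factor of \<open>?t k\<close> depends on spin \<open>k\<close>, so
      this term leaves the sum.\<close>
    have "spin_diff k (?t k) x = 0"
      using \<open>j \<noteq> k\<close> by (simp add: spin_diff_def fun_upd_twist[of k j])
    then have "(\<Sum>i\<in>?V. spin_diff k (?t i) x) = (\<Sum>i\<in>?W. spin_diff k (?t i) x)"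
      using kV by (simp add: sum.remove)
    then have "\<bar>?r x\<bar> = \<bar>\<Sum>i\<in>?W. spin_diff k (?t i) x + spin_diff k (?q i) x * spin_diff i ?u (x(k := -1))\<bar>"
      by (simp add: sum.distrib)
    also have "\<dots> \<le> (\<Sum>i\<in>?W. 8 * K * (A i j * A i k) + A i j * U i k + A i k * U i j)"
    proof (rule order_trans[OF sum_abs sum_mono])
      fix i assume i: "i \<in> ?W"
      then have iV: "i \<in> {1..n}" "i \<noteq> j" "i \<noteq> k" by auto
      have A: "0 \<le> A i j" "0 \<le> A i k" using A_nonneg iV j k by auto
      have "spin_diff k (?t i) x = spin_diff k (spin_diff j (plus_prob i)) x * spin_diff i F (x(k := 1, j := -1))
          + spin_diff j (plus_prob i) (x(k := -1)) * spin_diff k (spin_diff i F) (x(j := -1))"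
        unfolding spin_diff_mult using \<open>j \<noteq> k\<close> by (simp add: spin_diff_def[of k] fun_upd_twist[of k j])
      moreover have "\<bar>spin_diff k (spin_diff j (plus_prob i)) x * spin_diff i F (x(k := 1, j := -1))\<bar>
          \<le> 4 * A i j * A i k * (2 * K)"
        unfolding abs_mult using A iV j k x \<open>j \<noteq> k\<close>
        by (intro mult_mono spin_diff2_plus_prob_le abs_spin_diff_F_le \<Omega>_upd) auto
      moreover have "\<bar>spin_diff j (plus_prob i) (x(k := -1)) * spin_diff k (spin_diff i F) (x(j := -1))\<bar>
          \<le> A i j * U i k"
        unfolding abs_mult using spin_diff_plus_prob_bounds[of i j "x(k := -1)"] A iV j x
        by (intro mult_mono U_ge \<Omega>_upd) auto
      moreover have "\<bar>spin_diff k (?q i) x * spin_diff i ?u (x(k := -1))\<bar> \<le> A i k * U i j"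
      proof -
        have "spin_diff k (?q i) x = spin_diff k (plus_prob i) (x(j := 1))"
          using \<open>j \<noteq> k\<close> by (simp add: spin_diff_def fun_upd_twist[of k j])
        then show ?thesis
          unfolding abs_mult U_commute[of i j]
          using spin_diff_plus_prob_bounds[of i k "x(j := 1)"] A iV k x
          by (intro mult_mono U_ge \<Omega>_upd) auto
      qed
      ultimately show "\<bar>spin_diff k (?t i) x + spin_diff k (?q i) x * spin_diff i ?u (x(k := -1))\<bar>
          \<le> 8 * K * (A i j * A i k) + A i j * U i k + A i k * U i j"
        by (simp add: mult_ac)
    qed
    finally show ?thesis .
  qed
  obtain y where y: "y \<in> \<Omega>" "U j k = \<bar>spin_diff k ?u y\<bar>" by (rule U_attained)
  have "2 * \<bar>spin_diff k ?u y\<bar> \<le> (\<Sum>i\<in>?W. 8 * K * (A i j * A i k) + A i j * U i k + A i k * U i j)"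
    by (rule flip_gen_abs_max_principle[OF _ finite_\<Omega> _ _ eq r _ y(1)])
      (use \<Omega>_upd plus_prob_bounds in auto)
  then show ?thesis using y(2) by simp
qed

text \<open>Summing the recursion over \<open>k\<close> bounds each row sum by the largest one,
  \<open>Rm\<close>. Each term linear in \<open>U\<close> has a row or column sum of
  \<open>A\<close> as a factor, so \<open>2 * Rm \<le> 8 * K * \<alpha> + 2 * \<alpha> * Rm\<close>,
  and solving for \<open>Rm\<close> costs another factor \<open>K\<close>.\<close>

lemma U_row_sum:
  assumes "j \<in> {1..n}"
  shows "(\<Sum>k\<in>{1..n} - {j}. U j k) \<le> 4 * K\<^sup>2"
proof -
  define R where "R j = (\<Sum>k\<in>{1..n} - {j}. U j k)" for j
  define Rm where "Rm = Max (R ` {1..n})"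
  have Rm: "R j \<le> Rm" if "j \<in> {1..n}" for j
    unfolding Rm_def using that by (intro Max_ge) auto
  have R0: "0 \<le> R j" for j by (simp add: R_def sum_nonneg U_nonneg)
  have Rm0: "0 \<le> Rm" using Rm[OF assms] R0[of j] by simp
  have rec: "2 * R j \<le> 8 * K * \<alpha> + 2 * (\<alpha> * Rm)" if j: "j \<in> {1..n}" for j
  proof -
    let ?V = "{1..n} - {j}"
    have AV: "0 \<le> A i k" if "i \<in> ?V" "k \<in> ?V - {i}" for i k
      using A_nonneg that by auto
    have row: "(\<Sum>k\<in>?V - {i}. A i k) \<le> \<alpha>" if i: "i \<in> ?V" for i
    proof -
      have "(\<Sum>k\<in>?V - {i}. A i k) \<le> (\<Sum>k\<in>{1..n} - {i}. A i k)"
        using i A_nonneg by (intro sum_mono2) auto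
      also have "\<dots> \<le> \<alpha>" using i by (intro row_sum) auto
      finally show ?thesis .
    qed
    have "2 * R j = (\<Sum>k\<in>?V. 2 * U j k)" by (simp add: R_def sum_distrib_left)
    also have "\<dots> \<le> (\<Sum>k\<in>?V. \<Sum>i\<in>?V - {k}. 8 * K * (A i j * A i k) + A i j * U i k + A i k * U i j)"
      using j by (intro sum_mono U_recursion) auto
    also have "\<dots> = (\<Sum>i\<in>?V. \<Sum>k\<in>?V - {i}. 8 * K * (A i j * A i k) + A i j * U i k + A i k * U i j)"
      by (rule sum_sum_swap_diff) simp
    also have "\<dots> = (\<Sum>i\<in>?V. (8 * K * A i j + U i j) * (\<Sum>k\<in>?V - {i}. A i k) + A i j * (\<Sum>k\<in>?V - {i}. U i k))"
      by (simp add: sum.distrib sum_distrib_left algebra_simps)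
    also have "\<dots> \<le> (\<Sum>i\<in>?V. (8 * K * A i j + U i j) * \<alpha> + A i j * Rm)"
    proof (intro sum_mono add_mono mult_left_mono)
      fix i assume i: "i \<in> ?V"
      show "(\<Sum>k\<in>?V - {i}. A i k) \<le> \<alpha>" using row[OF i] .
      show A: "0 \<le> A i j" using A_nonneg i j by auto
      show "0 \<le> 8 * K * A i j + U i j" using A K_ge_1 U_nonneg by simp
      have "(\<Sum>k\<in>?V - {i}. U i k) \<le> R i"
        unfolding R_def using U_nonneg by (intro sum_mono2) auto
      also have "\<dots> \<le> Rm" using i by (intro Rm) auto
      finally show "(\<Sum>k\<in>?V - {i}. U i k) \<le> Rm" .
    qed
    also have "\<dots> = (8 * K * \<alpha> + Rm) * (\<Sum>i\<in>?V. A i j) + \<alpha> * R j"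
      unfolding R_def U_commute[of j] by (simp add: sum.distrib sum_distrib_left algebra_simps)
    also have "\<dots> \<le> (8 * K * \<alpha> + Rm) * \<alpha> + \<alpha> * Rm"
      using sum_A_le[OF j] Rm[OF j] Rm0 \<alpha>_nonneg K_ge_1 by (intro add_mono mult_left_mono) auto
    also have "\<dots> \<le> 8 * K * \<alpha> * 1 + 2 * (\<alpha> * Rm)"
      using mult_left_mono[of \<alpha> 1 "8 * K * \<alpha>"] \<alpha>_nonneg \<alpha>_less_1 K_ge_1
      by (simp add: algebra_simps)
    finally show ?thesis by simp
  qed
  have "Rm \<in> R ` {1..n}" unfolding Rm_def using n_pos by (intro Max_in) auto
  then have "2 * Rm \<le> 8 * K * \<alpha> + 2 * (\<alpha> * Rm)" using rec by auto
  moreover have "8 * K * \<alpha> \<le> 8 * K" using K_ge_1 \<alpha>_less_1 by simp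
  ultimately have "(1 - \<alpha>) * Rm \<le> 4 * K" by (simp add: algebra_simps)
  then have "K * ((1 - \<alpha>) * Rm) \<le> K * (4 * K)" using K_ge_1 by (intro mult_left_mono) auto
  moreover have "K * ((1 - \<alpha>) * Rm) = Rm" using \<alpha>_less_1 by (simp add: K_def)
  ultimately show ?thesis using Rm[OF assms] by (simp add: R_def power2_eq_square)
qed

text \<open>Half the Dirichlet integrand of \<open>F\<close> against \<open>mag\<close>, because
  \<open>spin_diff i mag\<close> is 2.\<close>

definition T :: "(nat \<Rightarrow> real) \<Rightarrow> real" where
  "T x = (\<Sum>i=1..n. cond_var i x * spin_diff i F x)"

text \<open>By the product rule the change splits into that of the weights, controlled by a column
  sum of \<open>A\<close>, and that of the first differences of \<open>F\<close>, controlled by a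
  row sum of \<open>U\<close>. The summand at \<open>k\<close> does not depend on spin
  \<open>k\<close>.\<close>

lemma spin_diff_T_le:
  assumes k: "k \<in> {1..n}" and x: "x \<in> \<Omega>"
  shows "\<bar>spin_diff k T x\<bar> \<le> 3 * K\<^sup>2"
proof -
  let ?t = "\<lambda>i x. cond_var i x * spin_diff i F x"
  have "spin_diff k T x = (\<Sum>i=1..n. spin_diff k (?t i) x)"
    unfolding T_def by (rule spin_diff_sum)
  also have "\<dots> = (\<Sum>i\<in>{1..n} - {k}. spin_diff k (?t i) x)"
    using k by (simp add: sum.remove[of _ k] spin_diff_def[of k "?t k"])
  also have "\<bar>\<dots>\<bar> \<le> (\<Sum>i\<in>{1..n} - {k}. A i k * (2 * K) + 1 / 4 * U k i)"
  proof (rule order_trans[OF sum_abs sum_mono])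
    fix i assume i: "i \<in> {1..n} - {k}"
    have "\<bar>spin_diff k (cond_var i) x * spin_diff i F (x(k := 1))\<bar> \<le> A i k * (2 * K)"
      unfolding abs_mult using i k x A_nonneg[of i k]
      by (intro mult_mono spin_diff_cond_var_le abs_spin_diff_F_le \<Omega>_upd) auto
    moreover have "\<bar>cond_var i (x(k := -1)) * spin_diff k (spin_diff i F) x\<bar> \<le> 1 / 4 * U k i"
      unfolding abs_mult U_commute[of k] using cond_var_bounds[of i "x(k := -1)"] x
      by (intro mult_mono U_ge) auto
    ultimately show "\<bar>spin_diff k (?t i) x\<bar> \<le> A i k * (2 * K) + 1 / 4 * U k i"
      unfolding spin_diff_mult by linarith
  qed
  also have "\<dots> = 2 * K * (\<Sum>i\<in>{1..n} - {k}. A i k) + 1 / 4 * (\<Sum>i\<in>{1..n} - {k}. U k i)"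
    by (simp add: sum.distrib sum_distrib_left algebra_simps)
  also have "\<dots> \<le> 2 * K * \<alpha> + 1 / 4 * (4 * K\<^sup>2)"
    using sum_A_le[OF k] U_row_sum[OF k] K_ge_1 by (intro add_mono mult_left_mono) auto
  also have "2 * K * \<alpha> \<le> 2 * K * K"
    using K_ge_1 \<alpha>_less_1 by (intro mult_left_mono) auto
  finally show ?thesis by (simp add: power2_eq_square)
qed

section \<open>Approximate Stein identity for the magnetization\<close>

lemma ex_mag_mult:
  "ex (\<lambda>x. (mag x - ex mag) * g x) = (\<Sum>i=1..n. ex (\<lambda>x. cond_var i x * spin_diff i F x * spin_diff i g x))"
proof -
  \<comment> \<open>The centred magnetization is minus the generator applied to \<open>F\<close>, so
    the Dirichlet form acts as integration by parts.\<close>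
  have "ex (\<lambda>x. (mag x - ex mag) * g x) = ex (\<lambda>x. (-1) * (glauber F x * g x))"
    by (rule ex_cong) (simp add: F algebra_simps)
  then show ?thesis
    by (simp only: ex_cmult dirichlet_form)
qed

lemma variance_mag: "ex (\<lambda>x. (mag x - ex mag)\<^sup>2) = 2 * ex T"
proof -
  have "ex (\<lambda>x. (mag x - ex mag)\<^sup>2) =
      (\<Sum>i=1..n. ex (\<lambda>x. cond_var i x * spin_diff i F x * spin_diff i (\<lambda>x. mag x - ex mag) x))"
    unfolding power2_eq_square by (rule ex_mag_mult)
  also have "\<dots> = (\<Sum>i=1..n. ex (\<lambda>x. 2 * (cond_var i x * spin_diff i F x)))"
    using spin_diff_mag by (intro sum.cong) (auto simp: spin_diff_def[of _ "\<lambda>x. mag x - ex mag"] spin_diff_def[of _ mag] mult_ac)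
  also have "\<dots> = 2 * ex T"
    unfolding T_def ex_cmult ex_sum by (simp add: sum_distrib_left)
  finally show ?thesis .
qed

lemma cond_var_spin_diff_le:
  assumes "i \<in> {1..n}" "x \<in> \<Omega>" "\<bar>e\<bar> \<le> B"
  shows "\<bar>cond_var i x * spin_diff i F x * e\<bar> \<le> K / 2 * B"
proof -
  have "\<bar>cond_var i x * spin_diff i F x * e\<bar> \<le> 1 / 4 * (2 * K) * B"
    unfolding abs_mult using cond_var_bounds[of i x] assms K_ge_1
    by (intro mult_mono abs_spin_diff_F_le) auto
  then show ?thesis by simp
qed

lemma variance_mag_le: "ex (\<lambda>x. (mag x - ex mag)\<^sup>2) \<le> K * n"
proof -
  have "\<bar>T x\<bar> \<le> (\<Sum>i=1..n. K / 2 * 1)" if "x \<in> \<Omega>" for x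
    unfolding T_def using cond_var_spin_diff_le[OF _ that, of _ 1 1]
    by (intro order_trans[OF sum_abs sum_mono]) auto
  then have "\<bar>ex T\<bar> \<le> n * (K / 2)" by (intro ex_abs_le) simp
  then show ?thesis unfolding variance_mag by (simp add: algebra_simps)
qed

text \<open>First differences of \<open>F\<close> are at least 2, so \<open>T\<close> is at least
  \<open>2 * c * n\<close>, and the variance is twice the mean of \<open>T\<close>.\<close>

lemma variance_mag_ge:
  assumes "\<And>i x. i \<in> {1..n} \<Longrightarrow> x \<in> \<Omega> \<Longrightarrow> c \<le> cond_var i x" "0 \<le> c"
  shows "4 * c * n \<le> ex (\<lambda>x. (mag x - ex mag)\<^sup>2)"
proof -
  have "(\<Sum>i=1..n. c * 2) \<le> T x" if "x \<in> \<Omega>" for x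
    unfolding T_def using that assms cond_var_bounds
    by (intro sum_mono mult_mono spin_diff_F_ge) auto
  then have "ex (\<lambda>x. 2 * c * n) \<le> ex T" by (intro ex_mono) (simp add: mult_ac)
  then show ?thesis unfolding variance_mag by simp
qed

lemma ex_abs_square_le: "(ex (\<lambda>x. \<bar>f x\<bar>))\<^sup>2 \<le> ex (\<lambda>x. (f x)\<^sup>2)"
proof -
  define c where "c = ex (\<lambda>x. \<bar>f x\<bar>)"
  have "ex (\<lambda>x. 0) \<le> ex (\<lambda>x. ((f x)\<^sup>2 + c\<^sup>2) - 2 * c * \<bar>f x\<bar>)"
  proof (rule ex_mono)
    fix x
    have "0 \<le> (\<bar>f x\<bar> - c)\<^sup>2" by simp
    then show "0 \<le> ((f x)\<^sup>2 + c\<^sup>2) - 2 * c * \<bar>f x\<bar>"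
      by (simp add: power2_diff algebra_simps)
  qed
  also have "\<dots> = ex (\<lambda>x. (f x)\<^sup>2) + c\<^sup>2 - 2 * c * c"
    unfolding ex_diff ex_add ex_cmult by (simp add: c_def)
  finally show ?thesis by (simp add: power2_eq_square flip: c_def)
qed

text \<open>A second Poisson equation, now for \<open>T\<close>, writes the variance of
  \<open>T\<close> as a Dirichlet form. Each site contributes a bounded amount, since the first
  differences of \<open>T\<close>, and hence those of \<open>G\<close>, are bounded; so the variance
  is of order \<open>n\<close>.\<close>

lemma ex_abs_T_le: "ex (\<lambda>x. \<bar>T x - ex T\<bar>) \<le> 3 / 2 * K ^ 3 * sqrt n"
proof -
  obtain G where G: "\<And>x. x \<in> \<Omega> \<Longrightarrow> glauber G x = ex T - T x"
    using poisson_equation by blast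
  let ?Y = "\<lambda>x. T x - ex T"
  have "ex (\<lambda>x. (?Y x)\<^sup>2) = ex (\<lambda>x. (-1) * (glauber G x * ?Y x))"
    by (rule ex_cong) (simp add: G power2_eq_square algebra_simps)
  also have "\<dots> = (\<Sum>i=1..n. ex (\<lambda>x. cond_var i x * spin_diff i G x * spin_diff i ?Y x))"
    by (simp only: ex_cmult dirichlet_form)
  also have "\<dots> \<le> (\<Sum>i=1..n. 1 / 4 * (3 * K\<^sup>2 * K) * (3 * K\<^sup>2))"
  proof (rule sum_mono)
    fix i assume i: "i \<in> {1..n}"
    have "\<bar>ex (\<lambda>x. cond_var i x * spin_diff i G x * spin_diff i ?Y x)\<bar> \<le> 1 / 4 * (3 * K\<^sup>2 * K) * (3 * K\<^sup>2)"
    proof (rule ex_abs_le)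
      fix x assume x: "x \<in> \<Omega>"
      have "\<bar>spin_diff i G x\<bar> \<le> 3 * K\<^sup>2 * K"
        using spin_diff_poisson_le[OF G spin_diff_T_le i x] by (simp add: K_def)
      moreover have "spin_diff i ?Y x = spin_diff i T x" by (simp add: spin_diff_def)
      ultimately show "\<bar>cond_var i x * spin_diff i G x * spin_diff i ?Y x\<bar> \<le> 1 / 4 * (3 * K\<^sup>2 * K) * (3 * K\<^sup>2)"
        unfolding abs_mult using cond_var_bounds[of i x] spin_diff_T_le[OF i x] K_ge_1
        by (intro mult_mono) auto
    qed
    then show "ex (\<lambda>x. cond_var i x * spin_diff i G x * spin_diff i ?Y x) \<le> 1 / 4 * (3 * K\<^sup>2 * K) * (3 * K\<^sup>2)"
      by linarith
  qed
  also have "\<dots> = 9 / 4 * K ^ 5 * n" by (simp add: eval_nat_numeral)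
  \<comment> \<open>The power is raised to an even one so that the bound is a perfect
    square.\<close>
  also have "\<dots> \<le> 9 / 4 * K ^ 6 * n"
    using K_ge_1 by (intro mult_right_mono mult_left_mono power_increasing) auto
  also have "\<dots> = (3 / 2 * K ^ 3 * sqrt n)\<^sup>2"
    by (simp add: power_mult_distrib flip: power_mult) (simp add: power2_eq_square)
  finally have "(ex (\<lambda>x. \<bar>?Y x\<bar>))\<^sup>2 \<le> (3 / 2 * K ^ 3 * sqrt n)\<^sup>2"
    using ex_abs_square_le[of ?Y] by linarith
  then show ?thesis
    by (rule power2_le_imp_le) (use K_ge_1 in simp)
qed

text \<open>Two replacements in \<open>ex_mag_mult\<close>: the difference of
  \<open>g (mag x)\<close> by \<open>2 * g' (mag x)\<close>, at a cost governed by
  \<open>K2\<close>, and then \<open>T\<close> by its mean, at a cost governed by \<open>K1\<close>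
  and the mean deviation of \<open>T\<close>.\<close>

theorem stein_bound:
  assumes deriv: "\<And>y. (g has_real_derivative g' y) (at y)"
    and K1: "\<And>y. \<bar>g' y\<bar> \<le> K1" and K2: "\<And>y z. \<bar>g' y - g' z\<bar> \<le> K2 * \<bar>y - z\<bar>"
  shows "\<bar>ex (\<lambda>x. (mag x - ex mag) * g (mag x)) - ex (\<lambda>x. (mag x - ex mag)\<^sup>2) * ex (\<lambda>x. g' (mag x))\<bar>
    \<le> 3 * K ^ 3 * (K1 * sqrt n + K2 * n)"
proof -
  let ?G = "\<lambda>x. g (mag x)" and ?G' = "\<lambda>x. g' (mag x)"
  have K10: "0 \<le> K1" using K1[of 0] by linarith
  have K20: "0 \<le> K2" using K2[of 1 0] by simp
  \<comment> \<open>Flipping a spin moves the magnetization across an interval of length 2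
    containing \<open>mag x\<close>. The mean value theorem evaluates \<open>g'\<close> within
    distance 2 of \<open>mag x\<close>, giving \<open>2 * (K2 * 2)\<close>.\<close>
  have step: "\<bar>spin_diff i ?G x - 2 * ?G' x\<bar> \<le> 4 * K2" if i: "i \<in> {1..n}" and x: "x \<in> \<Omega>" for i x
  proof -
    let ?a = "mag (x(i := -1))" and ?b = "mag (x(i := 1))"
    have ab: "?b - ?a = 2" "?a \<le> mag x" "mag x \<le> ?b"
      using mag_upd[OF i] \<Omega>_val[OF x i] by auto
    then obtain z where z: "?a < z" "z < ?b" "g ?b - g ?a = (?b - ?a) * g' z"
      using MVT2[of ?a ?b g g'] deriv by auto
    have "spin_diff i ?G x - 2 * ?G' x = 2 * (g' z - ?G' x)"
      using z(3) ab(1) by (simp add: spin_diff_def)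
    moreover have "K2 * \<bar>z - mag x\<bar> \<le> K2 * 2"
      using z(1,2) ab K20 by (intro mult_left_mono) auto
    ultimately show ?thesis using K2[of z "mag x"] by (auto simp: abs_mult)
  qed
  have "ex (\<lambda>x. (mag x - ex mag) * ?G x) - ex (\<lambda>x. (mag x - ex mag)\<^sup>2) * ex ?G' =
     ex (\<lambda>x. \<Sum>i=1..n. cond_var i x * spin_diff i F x * (spin_diff i ?G x - 2 * ?G' x))
     + 2 * ex (\<lambda>x. (T x - ex T) * ?G' x)"
  proof -
    have "(\<Sum>i=1..n. cond_var i x * spin_diff i F x * (spin_diff i ?G x - 2 * ?G' x)) =
        (\<Sum>i=1..n. cond_var i x * spin_diff i F x * spin_diff i ?G x) - 2 * (T x * ?G' x)" for x
      by (simp add: T_def algebra_simps sum_subtractf sum_distrib_left)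
    moreover have "(T x - ex T) * ?G' x = T x * ?G' x - ex T * ?G' x" for x
      by (simp add: algebra_simps)
    ultimately show ?thesis
      unfolding ex_mag_mult variance_mag by (simp only: ex_diff ex_cmult ex_sum) (simp add: algebra_simps)
  qed
  moreover have "\<bar>ex (\<lambda>x. \<Sum>i=1..n. cond_var i x * spin_diff i F x * (spin_diff i ?G x - 2 * ?G' x))\<bar>
      \<le> 2 * K * K2 * n"
  proof (rule ex_abs_le)
    fix x assume x: "x \<in> \<Omega>"
    have "\<bar>\<Sum>i=1..n. cond_var i x * spin_diff i F x * (spin_diff i ?G x - 2 * ?G' x)\<bar> \<le>
        (\<Sum>i=1..n. K / 2 * (4 * K2))"
      using x by (intro order_trans[OF sum_abs sum_mono] cond_var_spin_diff_le step)
    then show "\<bar>\<Sum>i=1..n. cond_var i x * spin_diff i F x * (spin_diff i ?G x - 2 * ?G' x)\<bar> \<le> 2 * K * K2 * n"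
      by (simp add: mult_ac)
  qed
  moreover have "2 * K * K2 * n \<le> 3 * K ^ 3 * (K2 * n)"
  proof -
    have "2 * K \<le> 3 * K ^ 3" using power_increasing[of 1 3 K] K_ge_1 by simp
    then have "2 * K * (K2 * n) \<le> 3 * K ^ 3 * (K2 * n)" using K20 by (intro mult_right_mono) auto
    then show ?thesis by (simp add: mult_ac)
  qed
  moreover have "\<bar>ex (\<lambda>x. (T x - ex T) * ?G' x)\<bar> \<le> K1 * (3 / 2 * K ^ 3 * sqrt n)"
  proof -
    have "\<bar>ex (\<lambda>x. (T x - ex T) * ?G' x)\<bar> \<le> ex (\<lambda>x. K1 * \<bar>T x - ex T\<bar>)"
    proof -
      have "\<bar>(T x - ex T) * ?G' x\<bar> \<le> K1 * \<bar>T x - ex T\<bar>" for x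
        using K1[of "mag x"] by (simp add: abs_mult mult.commute mult_right_mono)
      then have "(T x - ex T) * ?G' x \<le> K1 * \<bar>T x - ex T\<bar>"
        "(- 1) * (K1 * \<bar>T x - ex T\<bar>) \<le> (T x - ex T) * ?G' x" for x
        by (simp_all add: abs_le_iff) (metis minus_le_iff)
      then have "ex (\<lambda>x. (T x - ex T) * ?G' x) \<le> ex (\<lambda>x. K1 * \<bar>T x - ex T\<bar>)"
        "ex (\<lambda>x. (- 1) * (K1 * \<bar>T x - ex T\<bar>)) \<le> ex (\<lambda>x. (T x - ex T) * ?G' x)"
        by (auto intro: ex_mono)
      then show ?thesis unfolding ex_cmult by linarith
    qed
    also have "\<dots> \<le> K1 * (3 / 2 * K ^ 3 * sqrt n)"
      unfolding ex_cmult using ex_abs_T_le K10 by (rule mult_left_mono)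
    finally show ?thesis .
  qed
  ultimately have "\<bar>ex (\<lambda>x. (mag x - ex mag) * ?G x) - ex (\<lambda>x. (mag x - ex mag)\<^sup>2) * ex ?G'\<bar>
      \<le> 3 * K ^ 3 * (K2 * n) + 2 * (K1 * (3 / 2 * K ^ 3 * sqrt n))"
    by linarith
  then show ?thesis by (simp add: algebra_simps)
qed

end

subsection \<open>Characteristic function of the standardized magnetization\<close>

text \<open>With the integrating factor \<open>exp (\<tau>\<^sup>2 / 2)\<close> the derivative is
  the factor times \<open>e\<close>. On the interval between \<open>- \<bar>t\<bar>\<close> and
  \<open>\<bar>t\<bar>\<close> the factor is largest at the ends, so it cancels on dividing.\<close>

lemma gaussian_ode_bound:
  fixes f e :: "real \<Rightarrow> real"
  assumes deriv: "\<And>\<tau>. (f has_real_derivative (- \<tau> * f \<tau> + e \<tau>)) (at \<tau>)"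
    and e: "\<And>\<tau>. \<bar>\<tau>\<bar> \<le> \<bar>t\<bar> \<Longrightarrow> \<bar>e \<tau>\<bar> \<le> B"
  shows "\<bar>f t - f 0 * exp (- t\<^sup>2 / 2)\<bar> \<le> \<bar>t\<bar> * B"
proof -
  let ?g = "\<lambda>\<tau>. exp (\<tau>\<^sup>2 / 2) * f \<tau>" and ?g' = "\<lambda>\<tau>. exp (\<tau>\<^sup>2 / 2) * e \<tau>"
  have "norm (?g t - ?g 0) \<le> (exp (t\<^sup>2 / 2) * B) * norm (t - 0)"
  proof (rule field_differentiable_bound[of "{- \<bar>t\<bar>..\<bar>t\<bar>}" ?g ?g'])
    fix \<tau> assume \<tau>: "\<tau> \<in> {- \<bar>t\<bar>..\<bar>t\<bar>}"
    have "(?g has_real_derivative exp (\<tau>\<^sup>2 / 2) * \<tau> * f \<tau> + exp (\<tau>\<^sup>2 / 2) * (- \<tau> * f \<tau> + e \<tau>)) (at \<tau>)"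
      by (rule derivative_eq_intros deriv refl | simp)+
    moreover have "exp (\<tau>\<^sup>2 / 2) * \<tau> * f \<tau> + exp (\<tau>\<^sup>2 / 2) * (- \<tau> * f \<tau> + e \<tau>) = ?g' \<tau>"
      by (simp add: algebra_simps)
    ultimately show "(?g has_real_derivative ?g' \<tau>) (at \<tau> within {- \<bar>t\<bar>..\<bar>t\<bar>})"
      by (simp add: has_field_derivative_at_within)
    have "\<bar>\<tau>\<bar> \<le> \<bar>t\<bar>" using \<tau> by auto
    then have "\<tau>\<^sup>2 \<le> t\<^sup>2" by (simp add: abs_le_square_iff)
    then show "norm (?g' \<tau>) \<le> exp (t\<^sup>2 / 2) * B"
      unfolding real_norm_def abs_mult using e[OF \<open>\<bar>\<tau>\<bar> \<le> \<bar>t\<bar>\<close>] by (intro mult_mono) auto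
  qed auto
  then have "\<bar>exp (t\<^sup>2 / 2) * f t - f 0\<bar> \<le> exp (t\<^sup>2 / 2) * (\<bar>t\<bar> * B)"
    by (simp add: mult_ac)
  moreover have "exp (t\<^sup>2 / 2) * f t - f 0 = exp (t\<^sup>2 / 2) * (f t - f 0 * exp (- t\<^sup>2 / 2))"
    by (simp add: algebra_simps exp_minus)
  ultimately show ?thesis
    by (simp add: abs_mult)
qed

lemma sin_lipschitz: "\<bar>sin x - sin y\<bar> \<le> \<bar>x - y\<bar>" for x y :: real
proof -
  have "norm (sin x - sin y) \<le> 1 * norm (x - y)"
    by (rule field_differentiable_bound[of UNIV sin cos])
      (auto intro: DERIV_sin has_field_derivative_at_within)
  then show ?thesis by simp
qed

lemma cos_lipschitz: "\<bar>cos x - cos y\<bar> \<le> \<bar>x - y\<bar>" for x y :: real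
  using sin_lipschitz[of "pi / 2 - x" "pi / 2 - y"] by (simp add: sin_cos_eq flip: cos_sin_eq)

context mag_poisson
begin

definition std_mag :: "(nat \<Rightarrow> real) \<Rightarrow> real" where
  "std_mag x = (mag x - ex mag) / sqrt (ex (\<lambda>x. (mag x - ex mag)\<^sup>2))"

text \<open>The mean cosine and mean sine of \<open>\<tau> * std_mag x\<close> satisfy the Gaussian
  differential equation up to the defect in Stein's identity, bounded by \<open>stein_bound\<close>
  for a sine or cosine.\<close>

lemma char_std_mag_bound:
  assumes "0 < \<delta>" and \<delta>: "\<delta> * sqrt n \<le> sqrt (ex (\<lambda>x. (mag x - ex mag)\<^sup>2))"
  defines "B \<equiv> \<lambda>t. 3 * K ^ 3 * (\<bar>t\<bar> / \<delta>\<^sup>2 + t\<^sup>2 / \<delta> ^ 3) / sqrt n"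
  shows "\<bar>ex (\<lambda>x. cos (t * std_mag x)) - exp (- t\<^sup>2 / 2)\<bar> \<le> \<bar>t\<bar> * B t" (is ?cos)
    and "\<bar>ex (\<lambda>x. sin (t * std_mag x))\<bar> \<le> \<bar>t\<bar> * B t" (is ?sin)
proof -
  define v where "v = ex (\<lambda>x. (mag x - ex mag)\<^sup>2)"
  define s where "s = sqrt v"
  have n0: "0 < sqrt n" using n_pos by simp
  have s_ge: "\<delta> * sqrt n \<le> s" using \<delta> by (simp add: s_def v_def)
  have "0 < \<delta> * sqrt n" using \<open>0 < \<delta>\<close> n0 by simp
  then have s0: "0 < s" using s_ge by linarith
  then have v: "v = s\<^sup>2" by (simp add: s_def)
  have std: "std_mag x = (mag x - ex mag) / s" for x by (simp add: std_mag_def s_def v_def)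
  \<comment> \<open>The Stein error for frequency \<open>\<tau> / s\<close>, divided by the standard
    deviation \<open>s\<close>. As \<open>s\<close> is at least \<open>\<delta> * sqrt n\<close>,
    both terms are of order \<open>1 / sqrt n\<close>.\<close>
  have err: "3 * K ^ 3 * (\<bar>\<tau> / s\<bar> * sqrt n + (\<tau> / s)\<^sup>2 * n) / s \<le> B t" if "\<bar>\<tau>\<bar> \<le> \<bar>t\<bar>" for \<tau>
  proof -
    have "(\<bar>\<tau> / s\<bar> * sqrt n + (\<tau> / s)\<^sup>2 * n) / s = (\<bar>\<tau>\<bar> * (sqrt n / s)\<^sup>2 + \<tau>\<^sup>2 * (sqrt n / s) ^ 3) / sqrt n"
      using s0 n0 by (simp add: field_simps eval_nat_numeral)
    also have "\<dots> \<le> (\<bar>t\<bar> * (1 / \<delta>)\<^sup>2 + t\<^sup>2 * (1 / \<delta>) ^ 3) / sqrt n"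
    proof -
      have "sqrt n / s \<le> 1 / \<delta>" using s_ge s0 \<open>0 < \<delta>\<close> by (simp add: field_simps)
      moreover have "0 \<le> sqrt n / s" using s0 by simp
      moreover have "\<tau>\<^sup>2 \<le> t\<^sup>2" using that by (simp add: abs_le_square_iff)
      ultimately show ?thesis
        using that
        by (intro divide_right_mono add_mono mult_mono power_mono[of "sqrt n / s" "1 / \<delta>"]) auto
    qed
    finally have "3 * K ^ 3 * ((\<bar>\<tau> / s\<bar> * sqrt n + (\<tau> / s)\<^sup>2 * n) / s) \<le>
        3 * K ^ 3 * ((\<bar>t\<bar> * (1 / \<delta>)\<^sup>2 + t\<^sup>2 * (1 / \<delta>) ^ 3) / sqrt n)"
      using K_ge_1 by (intro mult_left_mono) auto
    then show ?thesis by (simp add: B_def power_divide)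
  qed
  \<comment> \<open>One factor \<open>r\<close> comes from the derivative and one from the argument,
    so \<open>r\<^sup>2\<close> serves as \<open>K2\<close> in \<open>stein_bound\<close>.\<close>
  have lip: "\<bar>r * a - r * b\<bar> \<le> r\<^sup>2 * \<bar>y - z\<bar>" if "\<bar>a - b\<bar> \<le> \<bar>r * (y - m) - r * (z - m)\<bar>" for a b r y z m :: real
  proof -
    have "\<bar>r * a - r * b\<bar> = \<bar>r\<bar> * \<bar>a - b\<bar>" by (simp flip: abs_mult right_diff_distrib)
    also have "\<dots> \<le> \<bar>r\<bar> * \<bar>r * (y - m) - r * (z - m)\<bar>" using that by (rule mult_left_mono) simp
    also have "r * (y - m) - r * (z - m) = r * (y - z)" by (simp add: algebra_simps)
    also have "\<bar>r\<bar> * \<bar>r * (y - z)\<bar> = r\<^sup>2 * \<bar>y - z\<bar>"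
      by (simp add: abs_mult power2_eq_square)
    finally show ?thesis .
  qed
  let ?m = "ex mag"
  let ?c = "\<lambda>\<tau>. ex (\<lambda>x. cos (\<tau> * std_mag x))" and ?s = "\<lambda>\<tau>. ex (\<lambda>x. sin (\<tau> * std_mag x))"
  define ec where "ec \<tau> = \<tau> * ?c \<tau> - ex (\<lambda>x. std_mag x * sin (\<tau> * std_mag x))" for \<tau>
  define es where "es \<tau> = \<tau> * ?s \<tau> + ex (\<lambda>x. std_mag x * cos (\<tau> * std_mag x))" for \<tau>
  have dc: "(?c has_real_derivative (- \<tau> * ?c \<tau> + ec \<tau>)) (at \<tau>)" for \<tau>
  proof -
    have "(?c has_real_derivative (\<Sum>x\<in>\<Omega>. gibbs x * (- sin (\<tau> * std_mag x) * std_mag x))) (at \<tau>)"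
      unfolding ex_def by (intro DERIV_sum DERIV_cmult) (auto intro!: derivative_eq_intros)
    moreover have "(\<Sum>x\<in>\<Omega>. gibbs x * (- sin (\<tau> * std_mag x) * std_mag x)) = - \<tau> * ?c \<tau> + ec \<tau>"
      by (simp add: ec_def) (simp add: ex_def mult_ac sum_negf)
    ultimately show ?thesis by simp
  qed
  have ds: "(?s has_real_derivative (- \<tau> * ?s \<tau> + es \<tau>)) (at \<tau>)" for \<tau>
  proof -
    have "(?s has_real_derivative (\<Sum>x\<in>\<Omega>. gibbs x * (cos (\<tau> * std_mag x) * std_mag x))) (at \<tau>)"
      unfolding ex_def by (intro DERIV_sum DERIV_cmult) (auto intro!: derivative_eq_intros)
    moreover have "(\<Sum>x\<in>\<Omega>. gibbs x * (cos (\<tau> * std_mag x) * std_mag x)) = - \<tau> * ?s \<tau> + es \<tau>"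
      by (simp add: es_def) (simp add: ex_def mult_ac)
    ultimately show ?thesis by simp
  qed
  have bc: "\<bar>ec \<tau>\<bar> \<le> B t" if "\<bar>\<tau>\<bar> \<le> \<bar>t\<bar>" for \<tau>
  proof -
    define r where "r = \<tau> / s"
    have arg: "r * (mag x - ?m) = \<tau> * std_mag x" for x by (simp add: r_def std)
    have "\<bar>ex (\<lambda>x. (mag x - ?m) * sin (r * (mag x - ?m))) - v * ex (\<lambda>x. r * cos (r * (mag x - ?m)))\<bar>
        \<le> 3 * K ^ 3 * (\<bar>r\<bar> * sqrt n + r\<^sup>2 * n)"
      unfolding v_def
    proof (rule stein_bound)
      fix y z
      show "((\<lambda>y. sin (r * (y - ?m))) has_real_derivative r * cos (r * (y - ?m))) (at y)"
        by (auto intro!: derivative_eq_intros)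
      show "\<bar>r * cos (r * (y - ?m))\<bar> \<le> \<bar>r\<bar>"
        using abs_cos_le_one[of "r * (y - ?m)"] by (simp add: abs_mult mult_left_le)
      show "\<bar>r * cos (r * (y - ?m)) - r * cos (r * (z - ?m))\<bar> \<le> r\<^sup>2 * \<bar>y - z\<bar>"
        by (rule lip[OF cos_lipschitz])
    qed
    moreover have "ex (\<lambda>x. (mag x - ?m) * sin (r * (mag x - ?m))) = s * ex (\<lambda>x. std_mag x * sin (\<tau> * std_mag x))"
      unfolding arg ex_cmult[symmetric] using s0 by (simp add: std)
    moreover have "v * ex (\<lambda>x. r * cos (r * (mag x - ?m))) = s * (\<tau> * ?c \<tau>)"
      unfolding arg ex_cmult using s0 by (simp add: v r_def power2_eq_square)
    ultimately have "\<bar>- (s * ec \<tau>)\<bar> \<le> 3 * K ^ 3 * (\<bar>r\<bar> * sqrt n + r\<^sup>2 * n)"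
      by (simp add: ec_def algebra_simps)
    then have "\<bar>ec \<tau>\<bar> \<le> 3 * K ^ 3 * (\<bar>r\<bar> * sqrt n + r\<^sup>2 * n) / s"
      using s0 by (simp add: abs_mult pos_le_divide_eq mult.commute)
    also have "\<dots> \<le> B t" unfolding r_def by (rule err[OF that])
    finally show ?thesis .
  qed
  have bs: "\<bar>es \<tau>\<bar> \<le> B t" if "\<bar>\<tau>\<bar> \<le> \<bar>t\<bar>" for \<tau>
  proof -
    define r where "r = \<tau> / s"
    have arg: "r * (mag x - ?m) = \<tau> * std_mag x" for x by (simp add: r_def std)
    have "\<bar>ex (\<lambda>x. (mag x - ?m) * cos (r * (mag x - ?m))) - v * ex (\<lambda>x. r * (- sin (r * (mag x - ?m))))\<bar>
        \<le> 3 * K ^ 3 * (\<bar>r\<bar> * sqrt n + r\<^sup>2 * n)"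
      unfolding v_def
    proof (rule stein_bound)
      fix y z
      show "((\<lambda>y. cos (r * (y - ?m))) has_real_derivative r * (- sin (r * (y - ?m)))) (at y)"
        by (auto intro!: derivative_eq_intros)
      show "\<bar>r * (- sin (r * (y - ?m)))\<bar> \<le> \<bar>r\<bar>"
        using abs_sin_le_one[of "r * (y - ?m)"] by (simp add: abs_mult mult_left_le)
      show "\<bar>r * (- sin (r * (y - ?m))) - r * (- sin (r * (z - ?m)))\<bar> \<le> r\<^sup>2 * \<bar>y - z\<bar>"
        by (rule lip[where m = ?m]) (use sin_lipschitz[of "r * (z - ?m)" "r * (y - ?m)"] in linarith)
    qed
    moreover have "ex (\<lambda>x. (mag x - ?m) * cos (r * (mag x - ?m))) = s * ex (\<lambda>x. std_mag x * cos (\<tau> * std_mag x))"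
      unfolding arg ex_cmult[symmetric] using s0 by (simp add: std)
    moreover have "v * ex (\<lambda>x. r * (- sin (r * (mag x - ?m)))) = - (s * (\<tau> * ?s \<tau>))"
    proof -
      have "ex (\<lambda>x. - sin (\<tau> * std_mag x)) = - ?s \<tau>" by (simp add: ex_def sum_negf)
      then show ?thesis unfolding arg ex_cmult using s0 by (simp add: v r_def power2_eq_square)
    qed
    ultimately have "\<bar>s * es \<tau>\<bar> \<le> 3 * K ^ 3 * (\<bar>r\<bar> * sqrt n + r\<^sup>2 * n)"
      by (simp add: es_def algebra_simps)
    then have "\<bar>es \<tau>\<bar> \<le> 3 * K ^ 3 * (\<bar>r\<bar> * sqrt n + r\<^sup>2 * n) / s"
      using s0 by (simp add: abs_mult pos_le_divide_eq mult.commute)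
    also have "\<dots> \<le> B t" unfolding r_def by (rule err[OF that])
    finally show ?thesis .
  qed
  \<comment> \<open>At 0 the mean cosine is 1 and the mean sine is 0, so the Gaussian term appears
    only for the cosine.\<close>
  show ?cos using gaussian_ode_bound[OF dc bc] by simp
  show ?sin using gaussian_ode_bound[OF ds bs] by simp
qed

end

section \<open>Transfer from the configuration space to the random vector\<close>

context high_temp_ising
begin

text \<open>The events that the vector equals \<open>x\<close> are disjoint and their probabilities
  sum to 1, so the integrand is almost surely a simple function. Banach-valued \<open>\<phi>\<close>
  covers both real moments and the complex characteristic function.\<close>

lemma ising_integral:
  fixes \<phi> :: "real \<Rightarrow> 'b::{banach, second_countable_topology}"
  assumes ising: "follows_ising M n A h X" and [measurable]: "\<phi> \<in> borel_measurable borel"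
  shows "has_bochner_integral M (\<lambda>\<omega>. \<phi> (\<Sum>i=1..n. X i \<omega>)) (\<Sum>x\<in>\<Omega>. gibbs x *\<^sub>R \<phi> (mag x))"
proof -
  interpret prob_space M using ising by (simp add: follows_ising_def)
  have [measurable]: "X i \<in> borel_measurable M" if "i \<in> {1..n}" for i
    using ising that by (simp add: follows_ising_def)
  define B where "B x = {\<omega> \<in> space M. \<forall>i\<in>{1..n}. X i \<omega> = x i}" for x
  have B_sets [measurable]: "B x \<in> sets M" for x
    unfolding B_def by measurable
  have prob_B: "prob (B x) = gibbs x" if "x \<in> \<Omega>" for x
    using ising that by (simp add: follows_ising_def B_def gibbs_def)
  have disj: "disjoint_family_on B \<Omega>"
    unfolding disjoint_family_on_def
  proof (intro ballI impI)
    fix x y assume "x \<in> \<Omega>" "y \<in> \<Omega>" "x \<noteq> y"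
    then obtain i where "i \<in> {1..n}" "x i \<noteq> y i"
      unfolding spin_configs_def by (metis PiE_ext)
    then show "B x \<inter> B y = {}" by (auto simp: B_def)
  qed
  have "prob (\<Union>x\<in>\<Omega>. B x) = (\<Sum>x\<in>\<Omega>. gibbs x)"
    using disj by (subst finite_measure_finite_Union) (auto simp: prob_B)
  then have "AE \<omega> in M. \<omega> \<in> (\<Union>x\<in>\<Omega>. B x)"
    using gibbs_sum by (subst prob_eq_1[symmetric]) auto
  then have AE: "AE \<omega> in M. (\<Sum>x\<in>\<Omega>. indicator (B x) \<omega> *\<^sub>R \<phi> (mag x)) = \<phi> (\<Sum>i=1..n. X i \<omega>)"
  proof (rule AE_mp, intro AE_I2 impI)
    fix \<omega> assume "\<omega> \<in> (\<Union>x\<in>\<Omega>. B x)"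
    then obtain x where x: "x \<in> \<Omega>" "\<omega> \<in> B x" by auto
    have "(\<Sum>y\<in>\<Omega>. indicator (B y) \<omega> *\<^sub>R \<phi> (mag y)) = (\<Sum>y\<in>\<Omega>. if y = x then \<phi> (mag x) else 0)"
      using x disj by (intro sum.cong) (auto simp: indicator_def disjoint_family_on_def)
    also have "\<dots> = \<phi> (mag x)" using x by simp
    also have "mag x = (\<Sum>i=1..n. X i \<omega>)" using x by (simp add: mag_def B_def)
    finally show "(\<Sum>x\<in>\<Omega>. indicator (B x) \<omega> *\<^sub>R \<phi> (mag x)) = \<phi> (\<Sum>i=1..n. X i \<omega>)" .
  qed
  have "has_bochner_integral M (\<lambda>\<omega>. \<Sum>x\<in>\<Omega>. indicator (B x) \<omega> *\<^sub>R \<phi> (mag x)) (\<Sum>x\<in>\<Omega>. prob (B x) *\<^sub>R \<phi> (mag x))"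
    by (intro has_bochner_integral_sum has_bochner_integral_scaleR_left has_bochner_integral_real_indicator)
      (auto simp: emeasure_eq_measure)
  then have "has_bochner_integral M (\<lambda>\<omega>. \<phi> (\<Sum>i=1..n. X i \<omega>)) (\<Sum>x\<in>\<Omega>. prob (B x) *\<^sub>R \<phi> (mag x))"
    using AE by (subst has_bochner_integral_cong_AE[symmetric]) (auto intro!: borel_measurable_sum)
  then show ?thesis by (simp add: prob_B cong: sum.cong)
qed

lemma variance_bounds:
  fixes c :: real
  shows "ex (\<lambda>x. (mag x - ex mag)\<^sup>2) \<le> n / (1 - \<alpha>)"
    and "(\<And>i x. i \<in> {1..n} \<Longrightarrow> x \<in> \<Omega> \<Longrightarrow> c \<le> cond_var i x) \<Longrightarrow> 0 \<le> c \<Longrightarrow>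
      4 * c * n \<le> ex (\<lambda>x. (mag x - ex mag)\<^sup>2)"
proof -
  obtain F where F: "\<forall>x\<in>\<Omega>. glauber F x = ex mag - mag x"
    using poisson_equation by blast
  interpret mag_poisson n A h \<alpha> F
    using F by unfold_locales auto
  show "ex (\<lambda>x. (mag x - ex mag)\<^sup>2) \<le> n / (1 - \<alpha>)"
    using variance_mag_le by (simp add: K_def)
  show "4 * c * n \<le> ex (\<lambda>x. (mag x - ex mag)\<^sup>2)"
    if "\<And>i x. i \<in> {1..n} \<Longrightarrow> x \<in> \<Omega> \<Longrightarrow> c \<le> cond_var i x" "0 \<le> c"
    by (rule variance_mag_ge[OF that])
qed

lemma scaled_magnetization_moments:
  assumes ising: "follows_ising M n A h X"
  defines "W \<equiv> scaled_magnetization n X"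
  shows "W \<in> borel_measurable M"
    and "prob_space.expectation M W = ex mag / sqrt n"
    and "prob_space.variance M W = ex (\<lambda>x. (mag x - ex mag)\<^sup>2) / n"
    and "integrable M (\<lambda>\<omega>. (W \<omega> - prob_space.expectation M W)\<^sup>2)"
proof -
  have W: "W = (\<lambda>\<omega>. (\<Sum>i=1..n. X i \<omega>) / sqrt n)"
    by (simp add: W_def scaled_magnetization_def fun_eq_iff)
  have "X i \<in> borel_measurable M" if "i \<in> {1..n}" for i
    using ising that by (simp add: follows_ising_def)
  then show "W \<in> borel_measurable M"
    unfolding W by (intro borel_measurable_divide borel_measurable_sum) auto
  have "has_bochner_integral M W (\<Sum>x\<in>\<Omega>. gibbs x *\<^sub>R (mag x / sqrt n))"
    using ising_integral[OF ising, of "\<lambda>y. y / sqrt n"] by (simp add: W)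
  then have "prob_space.expectation M W = (\<Sum>x\<in>\<Omega>. gibbs x *\<^sub>R (mag x / sqrt n))"
    by (rule has_bochner_integral_integral_eq)
  then show \<mu>: "prob_space.expectation M W = ex mag / sqrt n"
    by (simp add: ex_def sum_divide_distrib)
  have eq: "(W \<omega> - prob_space.expectation M W)\<^sup>2 = ((\<Sum>i=1..n. X i \<omega>) - ex mag)\<^sup>2 / n" for \<omega>
    unfolding \<mu> by (simp add: W power_divide flip: diff_divide_distrib)
  have "has_bochner_integral M (\<lambda>\<omega>. (W \<omega> - prob_space.expectation M W)\<^sup>2)
      (\<Sum>x\<in>\<Omega>. gibbs x *\<^sub>R ((mag x - ex mag)\<^sup>2 / n))"
    unfolding eq by (rule ising_integral[OF ising, of "\<lambda>y. (y - ex mag)\<^sup>2 / n"]) simp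
  then show "integrable M (\<lambda>\<omega>. (W \<omega> - prob_space.expectation M W)\<^sup>2)"
    and "prob_space.variance M W = ex (\<lambda>x. (mag x - ex mag)\<^sup>2) / n"
    by (auto simp: has_bochner_integral_iff ex_def sum_divide_distrib)
qed

text \<open>The normalization by \<open>sqrt n\<close> cancels in the standardization, leaving
  \<open>std_mag\<close>. The modulus is at most the sum of the real and imaginary errors, hence the
  factor 2. The numerator is free of \<open>n\<close> and of the field, as the limit argument
  requires.\<close>

theorem char_standardized_bound:
  assumes ising: "follows_ising M n A h X"
  defines "W \<equiv> scaled_magnetization n X"
  defines "\<mu> \<equiv> prob_space.expectation M W" and "\<sigma> \<equiv> sqrt (prob_space.variance M W)"
  assumes "0 < \<delta>" "\<delta> \<le> \<sigma>"
  shows "cmod (char (distr M borel (\<lambda>\<omega>. (W \<omega> - \<mu>) / \<sigma>)) t - of_real (exp (- t\<^sup>2 / 2)))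
    \<le> (2 * \<bar>t\<bar> * (3 * (1 / (1 - \<alpha>)) ^ 3 * (\<bar>t\<bar> / \<delta>\<^sup>2 + t\<^sup>2 / \<delta> ^ 3))) / sqrt n"
proof -
  obtain F where F: "\<forall>x\<in>\<Omega>. glauber F x = ex mag - mag x"
    using poisson_equation by blast
  interpret mag_poisson n A h \<alpha> F
    using F by unfold_locales auto
  interpret prob_space M using ising by (simp add: follows_ising_def)
  note mom = scaled_magnetization_moments[OF ising, folded W_def]
  have [measurable]: "W \<in> borel_measurable M" by (rule mom(1))
  define s where "s = sqrt (ex (\<lambda>x. (mag x - ex mag)\<^sup>2))"
  have \<sigma>: "\<sigma> = s / sqrt n" by (simp add: \<sigma>_def mom(3) s_def real_sqrt_divide)
  have n0: "0 < sqrt n" using n_pos by simp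
  have \<delta>s: "\<delta> * sqrt n \<le> s" using assms(6) n0 by (simp add: \<sigma> field_simps)
  have V: "(W \<omega> - \<mu>) / \<sigma> = ((\<Sum>i=1..n. X i \<omega>) - ex mag) / s" for \<omega>
    unfolding \<sigma> \<mu>_def mom(2) using n0
    by (simp add: W_def scaled_magnetization_def flip: diff_divide_distrib)
  have std: "std_mag x = (mag x - ex mag) / s" for x by (simp add: std_mag_def s_def)
  let ?B = "3 * K ^ 3 * (\<bar>t\<bar> / \<delta>\<^sup>2 + t\<^sup>2 / \<delta> ^ 3) / sqrt n"
  have "char (distr M borel (\<lambda>\<omega>. (W \<omega> - \<mu>) / \<sigma>)) t = (CLINT \<omega>|M. iexp (t * ((W \<omega> - \<mu>) / \<sigma>)))"
    unfolding char_def by (subst integral_distr) auto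
  also have "\<dots> = (\<Sum>x\<in>\<Omega>. gibbs x *\<^sub>R iexp (t * std_mag x))"
    unfolding V std
    by (rule has_bochner_integral_integral_eq[OF ising_integral[OF ising, of "\<lambda>y. iexp (t * ((y - ex mag) / s))"]])
      measurable
  finally have char: "char (distr M borel (\<lambda>\<omega>. (W \<omega> - \<mu>) / \<sigma>)) t = (\<Sum>x\<in>\<Omega>. gibbs x *\<^sub>R iexp (t * std_mag x))" .
  let ?d = "char (distr M borel (\<lambda>\<omega>. (W \<omega> - \<mu>) / \<sigma>)) t - of_real (exp (- t\<^sup>2 / 2))"
  have "Re ?d = ex (\<lambda>x. cos (t * std_mag x)) - exp (- t\<^sup>2 / 2)" "Im ?d = ex (\<lambda>x. sin (t * std_mag x))"
    unfolding char by (simp_all add: ex_def Re_exp Im_exp)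
  then have "cmod ?d \<le> \<bar>t\<bar> * ?B + \<bar>t\<bar> * ?B"
    using char_std_mag_bound[OF \<open>0 < \<delta>\<close>, of t] \<delta>s cmod_le[of ?d]
    unfolding s_def by linarith
  then show ?thesis by (simp add: K_def)
qed

end

subsection \<open>Wasserstein distance to the normal law\<close>

lemma ennreal_sqrt_mono: "x \<le> y \<Longrightarrow> ennreal_sqrt x \<le> ennreal_sqrt y"
proof (cases "y = \<infinity>")
  case False
  moreover assume "x \<le> y"
  ultimately have "x \<noteq> \<infinity>" "enn2real x \<le> enn2real y"
    by (auto simp: top_unique intro!: enn2real_mono) (simp add: less_top)
  then show ?thesis
    using False by (simp add: ennreal_sqrt_def ennreal_leI)
qed (simp add: ennreal_sqrt_def)

lemma ennreal_sqrt_power2: "0 \<le> d \<Longrightarrow> ennreal_sqrt (ennreal (d\<^sup>2)) = ennreal d"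
  by (simp add: ennreal_sqrt_def)

text \<open>The joint law of \<open>P\<close> and \<open>Q\<close> is a coupling, so random
  variables on any common space bound the distance.\<close>

lemma wasserstein2_le:
  assumes "prob_space N"
    and [measurable]: "P \<in> borel_measurable N" "Q \<in> borel_measurable N"
    and "distr N borel P = \<mu>" "distr N borel Q = \<nu>"
    and le: "(\<integral>\<^sup>+ \<omega>. ennreal ((P \<omega> - Q \<omega>)\<^sup>2) \<partial>N) \<le> ennreal (d\<^sup>2)" and "0 \<le> d"
  shows "wasserstein2 \<mu> \<nu> \<le> ennreal d"
proof -
  interpret prob_space N by fact
  let ?\<gamma> = "distr N (borel \<Otimes>\<^sub>M borel) (\<lambda>\<omega>. (P \<omega>, Q \<omega>))"
  have "prob_space ?\<gamma>" by (rule prob_space_distr) measurable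
  moreover have "distr ?\<gamma> borel fst = \<mu>" "distr ?\<gamma> borel snd = \<nu>"
    using assms(4,5) by (simp_all add: distr_distr comp_def)
  ultimately have \<gamma>: "?\<gamma> \<in> couplings \<mu> \<nu>" by (simp add: couplings_def)
  have "(\<integral>\<^sup>+ (x, y). ennreal (\<bar>x - y\<bar>\<^sup>2) \<partial>?\<gamma>) = (\<integral>\<^sup>+ \<omega>. ennreal ((P \<omega> - Q \<omega>)\<^sup>2) \<partial>N)"
    by (subst nn_integral_distr) (auto simp: case_prod_beta)
  then have "ennreal_sqrt (\<integral>\<^sup>+ (x, y). ennreal (\<bar>x - y\<bar>\<^sup>2) \<partial>?\<gamma>) \<le> ennreal d"
    using ennreal_sqrt_mono[OF le] ennreal_sqrt_power2[OF \<open>0 \<le> d\<close>] by simp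
  then show ?thesis
    unfolding wasserstein2_def using \<gamma> by (intro INF_lower2)
qed

section \<open>Moments and couplings of normal laws\<close>

lemma std_normal_second_moment:
  "(\<integral>\<^sup>+ x. ennreal (x\<^sup>2) \<partial>std_normal_distribution) = 1"
proof -
  have "(\<integral>\<^sup>+ x. ennreal (x\<^sup>2) \<partial>std_normal_distribution) = (\<integral>\<^sup>+ x. ennreal (std_normal_density x * x ^ (2 * 1)) \<partial>lborel)"
    by (subst nn_integral_density) (auto simp: ennreal_mult)
  also have "\<dots> = 1"
    using std_normal_moment_even[of 1] unfolding has_bochner_integral_iff
    by (subst nn_integral_eq_integral) (auto simp: fact_numeral)
  finally show ?thesis .
qed

lemma distr_std_normal_affine:
  assumes "0 < \<sigma>"
  shows "distr std_normal_distribution borel (\<lambda>x. m + \<sigma> * x) = normal_law m (\<sigma>\<^sup>2)"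
proof -
  interpret prob_space std_normal_distribution by (rule prob_space_normal_density) simp
  have "distributed std_normal_distribution lborel (\<lambda>x. x) std_normal_density"
    unfolding distributed_def by (auto intro!: distr_id2)
  from normal_density_affine[OF this, of \<sigma> m] assms
  have "distributed std_normal_distribution lborel (\<lambda>x. m + \<sigma> * x) (normal_density m \<sigma>)"
    by simp
  then have "distr std_normal_distribution lborel (\<lambda>x. m + \<sigma> * x) = density lborel (normal_density m \<sigma>)"
    by (simp add: distributed_def)
  moreover have "distr std_normal_distribution lborel (\<lambda>x. m + \<sigma> * x) = distr std_normal_distribution borel (\<lambda>x. m + \<sigma> * x)"
    by (rule distr_cong) auto
  ultimately show ?thesis using assms by (simp add: normal_law_def)
qed

lemma normal_law_props:
  assumes "0 \<le> \<sigma>"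
  shows "prob_space (normal_law m (\<sigma>\<^sup>2))" "sets (normal_law m (\<sigma>\<^sup>2)) = sets borel"
    "(\<integral>\<^sup>+ x. ennreal ((x - m)\<^sup>2) \<partial>normal_law m (\<sigma>\<^sup>2)) = ennreal (\<sigma>\<^sup>2)"
proof -
  show "sets (normal_law m (\<sigma>\<^sup>2)) = sets borel" by (simp add: normal_law_def)
  show "prob_space (normal_law m (\<sigma>\<^sup>2))"
    using assms by (auto simp: normal_law_def prob_space_normal_density intro!: prob_space_return)
  show "(\<integral>\<^sup>+ x. ennreal ((x - m)\<^sup>2) \<partial>normal_law m (\<sigma>\<^sup>2)) = ennreal (\<sigma>\<^sup>2)"
  proof (cases "\<sigma> = 0")
    case True
    then show ?thesis by (simp add: normal_law_def nn_integral_return)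
  next
    case False
    then have "0 < \<sigma>" using assms by simp
    have "(\<integral>\<^sup>+ x. ennreal ((x - m)\<^sup>2) \<partial>normal_law m (\<sigma>\<^sup>2)) = (\<integral>\<^sup>+ x. ennreal (\<sigma>\<^sup>2) * ennreal (x\<^sup>2) \<partial>std_normal_distribution)"
      unfolding distr_std_normal_affine[OF \<open>0 < \<sigma>\<close>, symmetric]
      by (subst nn_integral_distr) (auto simp: power_mult_distrib ennreal_mult)
    also have "\<dots> = ennreal (\<sigma>\<^sup>2)"
      by (subst nn_integral_cmult) (auto simp: std_normal_second_moment)
    finally show ?thesis .
  qed
qed

lemma distr_pair_snd:
  assumes "prob_space M" "prob_space N"
  shows "distr (M \<Otimes>\<^sub>M N) N snd = N"
proof -
  interpret M: prob_space M by fact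
  interpret N: prob_space N by fact
  interpret pair_prob_space M N ..
  show ?thesis
  proof (rule measure_eqI)
    fix B assume "B \<in> sets (distr (M \<Otimes>\<^sub>M N) N snd)"
    then have B: "B \<in> sets N" by simp
    have "emeasure (distr (M \<Otimes>\<^sub>M N) N snd) B = emeasure (M \<Otimes>\<^sub>M N) (space M \<times> B)"
      using B sets.sets_into_space[OF B]
      by (auto simp: emeasure_distr space_pair_measure intro!: arg_cong2[where f = emeasure])
    also have "\<dots> = emeasure N B"
      using B by (simp add: N.emeasure_pair_measure_Times M.emeasure_space_1)
    finally show "emeasure (distr (M \<Otimes>\<^sub>M N) N snd) B = emeasure N B" .
  qed simp
qed

lemma ennreal_double_add:
  "0 \<le> a \<Longrightarrow> 0 \<le> b \<Longrightarrow> ennreal 2 * ennreal a + ennreal 2 * ennreal b = ennreal (2 * a + 2 * b)"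
  by (simp add: ennreal_mult ennreal_plus)

text \<open>Independent coupling: the squared distance is at most twice the sum of the squared
  deviations from the common mean, with expectation \<open>4 * \<sigma>\<^sup>2\<close>. This
  disposes of small \<open>\<sigma>\<close>, including 0.\<close>

lemma wasserstein2_normal_le:
  assumes "prob_space M" and W [measurable]: "W \<in> borel_measurable M" and "0 \<le> \<sigma>"
    and var: "(\<integral>\<^sup>+ \<omega>. ennreal ((W \<omega> - m)\<^sup>2) \<partial>M) = ennreal (\<sigma>\<^sup>2)"
  shows "wasserstein2 (distr M borel W) (normal_law m (\<sigma>\<^sup>2)) \<le> ennreal (2 * \<sigma>)"
proof -
  let ?L = "distr M borel W" and ?\<nu> = "normal_law m (\<sigma>\<^sup>2)"
  note [measurable_cong] = normal_law_props(2)[OF \<open>0 \<le> \<sigma>\<close>]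
  interpret M: prob_space M by fact
  interpret L: prob_space ?L by (rule M.prob_space_distr) simp
  interpret \<nu>: prob_space ?\<nu> using \<open>0 \<le> \<sigma>\<close> by (rule normal_law_props)
  interpret pair_prob_space ?L ?\<nu> ..
  have fst: "distr (?L \<Otimes>\<^sub>M ?\<nu>) borel fst = ?L"
    using \<nu>.distr_pair_fst[of ?L] by (simp cong: distr_cong)
  have snd: "distr (?L \<Otimes>\<^sub>M ?\<nu>) borel snd = ?\<nu>"
  proof -
    have "distr (?L \<Otimes>\<^sub>M ?\<nu>) borel snd = distr (?L \<Otimes>\<^sub>M ?\<nu>) ?\<nu> snd"
      by (rule distr_cong) (auto simp: normal_law_props(2)[OF \<open>0 \<le> \<sigma>\<close>])
    then show ?thesis using distr_pair_snd[of ?L ?\<nu>] L.prob_space_axioms \<nu>.prob_space_axioms by simp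
  qed
  have "(\<integral>\<^sup>+ p. ennreal ((fst p - snd p)\<^sup>2) \<partial>(?L \<Otimes>\<^sub>M ?\<nu>)) \<le>
      (\<integral>\<^sup>+ p. ennreal 2 * ennreal ((fst p - m)\<^sup>2) + ennreal 2 * ennreal ((snd p - m)\<^sup>2) \<partial>(?L \<Otimes>\<^sub>M ?\<nu>))"
  proof (rule nn_integral_mono)
    fix p :: "real \<times> real"
    have "0 \<le> ((fst p - m) + (snd p - m))\<^sup>2" by simp
    then have "(fst p - snd p)\<^sup>2 \<le> 2 * (fst p - m)\<^sup>2 + 2 * (snd p - m)\<^sup>2"
      by (simp add: power2_eq_square algebra_simps)
    then show "ennreal ((fst p - snd p)\<^sup>2) \<le> ennreal 2 * ennreal ((fst p - m)\<^sup>2) + ennreal 2 * ennreal ((snd p - m)\<^sup>2)"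
      unfolding ennreal_double_add[OF zero_le_power2 zero_le_power2] by (rule ennreal_leI)
  qed
  also have "\<dots> = ennreal 2 * (\<integral>\<^sup>+ p. ennreal ((fst p - m)\<^sup>2) \<partial>(?L \<Otimes>\<^sub>M ?\<nu>))
      + ennreal 2 * (\<integral>\<^sup>+ p. ennreal ((snd p - m)\<^sup>2) \<partial>(?L \<Otimes>\<^sub>M ?\<nu>))"
    by (subst nn_integral_add) (auto simp: nn_integral_cmult)
  also have "(\<integral>\<^sup>+ p. ennreal ((fst p - m)\<^sup>2) \<partial>(?L \<Otimes>\<^sub>M ?\<nu>)) = (\<integral>\<^sup>+ x. ennreal ((x - m)\<^sup>2) \<partial>?L)"
    by (subst (2) fst[symmetric], subst nn_integral_distr) auto
  also have "\<dots> = ennreal (\<sigma>\<^sup>2)"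
    by (subst nn_integral_distr) (auto simp: var)
  also have "(\<integral>\<^sup>+ p. ennreal ((snd p - m)\<^sup>2) \<partial>(?L \<Otimes>\<^sub>M ?\<nu>)) = (\<integral>\<^sup>+ x. ennreal ((x - m)\<^sup>2) \<partial>?\<nu>)"
    by (subst (2) snd[symmetric], subst nn_integral_distr) auto
  also have "\<dots> = ennreal (\<sigma>\<^sup>2)" using \<open>0 \<le> \<sigma>\<close> by (rule normal_law_props)
  also have "ennreal 2 * ennreal (\<sigma>\<^sup>2) + ennreal 2 * ennreal (\<sigma>\<^sup>2) = ennreal ((2 * \<sigma>)\<^sup>2)"
    by (subst ennreal_double_add) (auto simp: power_mult_distrib)
  finally show ?thesis
    using \<open>0 \<le> \<sigma>\<close> fst snd
    by (intro wasserstein2_le[of "?L \<Otimes>\<^sub>M ?\<nu>" fst snd] prob_space_axioms) auto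
qed

text \<open>Fatou applied to $(Y_k + Y)^2$ suffices because
  $(Y_k - Y)^2 + (Y_k + Y)^2 = 2 Y_k^2 + 2 Y^2$ has constant expectation.\<close>

lemma std_normal_L2_coupling:
  assumes real: "\<And>k. real_distribution (\<nu> k)"
    and conv: "weak_conv_m \<nu> std_normal_distribution"
    and mom: "\<And>k. (\<integral>\<^sup>+ x. ennreal (x\<^sup>2) \<partial>\<nu> k) = 1"
    and "0 < e"
  obtains k and N :: "real measure" and P Q where "prob_space N"
    "P \<in> borel_measurable N" "Q \<in> borel_measurable N"
    "distr N borel P = \<nu> k" "distr N borel Q = std_normal_distribution"
    "(\<integral>\<^sup>+ \<omega>. ennreal ((P \<omega> - Q \<omega>)\<^sup>2) \<partial>N) \<le> ennreal e"
proof -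
  obtain N :: "real measure" and Y :: "nat \<Rightarrow> real \<Rightarrow> real" and Z where N: "prob_space N"
    and Y [measurable]: "\<And>k. Y k \<in> measurable N borel" and dY: "\<And>k. distr N borel (Y k) = \<nu> k"
    and Z': "Z \<in> measurable N lborel" and dZ: "distr N borel Z = std_normal_distribution"
    and lim: "\<And>x. x \<in> space N \<Longrightarrow> (\<lambda>k. Y k x) \<longlonglongrightarrow> Z x"
    using Skorohod[OF real real_dist_normal_dist conv] by blast
  have Z [measurable]: "Z \<in> borel_measurable N" using Z' by simp
  have mY: "(\<integral>\<^sup>+ x. ennreal ((Y k x)\<^sup>2) \<partial>N) = 1" for k
    using mom[of k] unfolding dY[symmetric] by (subst (asm) nn_integral_distr) auto
  have mZ: "(\<integral>\<^sup>+ x. ennreal ((Z x)\<^sup>2) \<partial>N) = 1"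
    using std_normal_second_moment unfolding dZ[symmetric] by (subst (asm) nn_integral_distr) auto
  let ?a = "\<lambda>k. \<integral>\<^sup>+ x. ennreal ((Y k x + Z x)\<^sup>2) \<partial>N" and ?d = "\<lambda>k. \<integral>\<^sup>+ x. ennreal ((Y k x - Z x)\<^sup>2) \<partial>N"
  have sum: "?d k + ?a k = 4" for k
  proof -
    have "?d k + ?a k = (\<integral>\<^sup>+ x. ennreal ((Y k x - Z x)\<^sup>2) + ennreal ((Y k x + Z x)\<^sup>2) \<partial>N)"
      by (subst nn_integral_add) auto
    also have "\<dots> = (\<integral>\<^sup>+ x. ennreal 2 * ennreal ((Y k x)\<^sup>2) + ennreal 2 * ennreal ((Z x)\<^sup>2) \<partial>N)"
    proof (rule nn_integral_cong)
      fix x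
      have "ennreal ((Y k x - Z x)\<^sup>2) + ennreal ((Y k x + Z x)\<^sup>2) = ennreal ((Y k x - Z x)\<^sup>2 + (Y k x + Z x)\<^sup>2)"
        by simp
      also have "(Y k x - Z x)\<^sup>2 + (Y k x + Z x)\<^sup>2 = 2 * (Y k x)\<^sup>2 + 2 * (Z x)\<^sup>2"
        by (simp add: power2_eq_square algebra_simps)
      finally show "ennreal ((Y k x - Z x)\<^sup>2) + ennreal ((Y k x + Z x)\<^sup>2) =
          ennreal 2 * ennreal ((Y k x)\<^sup>2) + ennreal 2 * ennreal ((Z x)\<^sup>2)"
        by (simp only: ennreal_double_add zero_le_power2)
    qed
    also have "\<dots> = 4"
      by (subst nn_integral_add) (auto simp: nn_integral_cmult mY mZ)
    finally show ?thesis .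
  qed
  have "(\<integral>\<^sup>+ x. ennreal 4 * ennreal ((Z x)\<^sup>2) \<partial>N) = (\<integral>\<^sup>+ x. liminf (\<lambda>k. ennreal ((Y k x + Z x)\<^sup>2)) \<partial>N)"
  proof (rule nn_integral_cong)
    fix x assume "x \<in> space N"
    then have "(\<lambda>k. ennreal ((Y k x + Z x)\<^sup>2)) \<longlonglongrightarrow> ennreal ((Z x + Z x)\<^sup>2)"
      by (intro tendsto_ennrealI tendsto_intros lim)
    then have "liminf (\<lambda>k. ennreal ((Y k x + Z x)\<^sup>2)) = ennreal ((Z x + Z x)\<^sup>2)"
      by (intro lim_imp_Liminf) auto
    also have "\<dots> = ennreal 4 * ennreal ((Z x)\<^sup>2)"
      by (simp add: power2_eq_square ennreal_mult)
    finally show "ennreal 4 * ennreal ((Z x)\<^sup>2) = liminf (\<lambda>k. ennreal ((Y k x + Z x)\<^sup>2))" ..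
  qed
  also have "\<dots> \<le> liminf ?a" by (rule nn_integral_liminf) auto
  finally have "4 \<le> liminf ?a"
    by (simp add: nn_integral_cmult mZ)
  moreover have "ennreal (4 - e) < 4"
    using ennreal_lessI[of 4 "4 - e"] \<open>0 < e\<close> by simp
  ultimately have "\<forall>\<^sub>F k in sequentially. ennreal (4 - e) < ?a k"
    by (intro less_LiminfD) (rule less_le_trans)
  then obtain k where k: "ennreal (4 - e) < ?a k"
    by (auto simp: eventually_sequentially)
  \<comment> \<open>Both integrals are finite because they add up to 4, so the subtraction can be
    done in the reals.\<close>
  have "?a k \<noteq> \<infinity>" "?d k \<noteq> \<infinity>" using sum[of k] by auto
  then obtain a d where a: "?a k = ennreal a" "0 \<le> a" and d: "?d k = ennreal d" "0 \<le> d"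
    unfolding infinity_ennreal_def by (meson ennreal_cases)
  have "ennreal (d + a) = ennreal 4"
    using sum[of k] unfolding a d using a(2) d(2) by simp
  then have "d + a = 4"
    using a(2) d(2) by (subst (asm) ennreal_inj) auto
  moreover have "4 - e < a"
    using k unfolding a by (rule contrapos_pp) (simp add: not_less ennreal_leI)
  ultimately have "?d k \<le> ennreal e" unfolding d by (intro ennreal_leI) simp
  then show ?thesis using that[OF N Y Z dY dZ] by blast
qed

section \<open>Proof of the two limit statements\<close>

lemma high_temp_ising_of_row_sum:
  assumes "1 \<le> n"
    and sym: "\<And>i j. i \<in> {1..n} \<Longrightarrow> j \<in> {1..n} \<Longrightarrow> A i j = A j i"
    and nonneg: "\<And>i j. i \<in> {1..n} \<Longrightarrow> j \<in> {1..n} \<Longrightarrow> i \<noteq> j \<Longrightarrow> 0 \<le> A i j"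
    and row: "max_offdiag_row_sum n A \<le> \<alpha>" and "\<alpha> < 1"
  shows "high_temp_ising n A \<alpha>"
proof
  fix i assume i: "i \<in> {1..n}"
  have "(\<Sum>j\<in>{1..n} - {i}. A i j) = (\<Sum>j\<in>{1..n} - {i}. \<bar>A i j\<bar>)"
    using i nonneg by (intro sum.cong) auto
  also have "\<dots> \<le> max_offdiag_row_sum n A"
    unfolding max_offdiag_row_sum_def using i by (intro cSUP_upper) auto
  finally show "(\<Sum>j\<in>{1..n} - {i}. A i j) \<le> \<alpha>" using row by simp
qed (use assms in auto)

text \<open>The spins contribute at most \<open>\<alpha> < 1\<close> to the local field, which thus
  stays within \<open>C + 1\<close>; \<open>cond_var\<close> is a quarter of one minus the squared
  tanh of it.\<close>

lemma (in high_temp_ising) cond_var_ge: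
  assumes h: "\<bar>h i\<bar> \<le> C" and i: "i \<in> {1..n}" and x: "x \<in> \<Omega>"
  shows "(1 - (tanh (C + 1))\<^sup>2) / 4 \<le> cond_var i x"
proof -
  have "\<bar>\<Sum>j\<in>{1..n} - {i}. A i j * x j\<bar> \<le> (\<Sum>j\<in>{1..n} - {i}. A i j)"
  proof (rule order_trans[OF sum_abs sum_mono])
    fix j assume j: "j \<in> {1..n} - {i}"
    have "\<bar>x j\<bar> = 1" using \<Omega>_val[OF x, of j] j by auto
    then show "\<bar>A i j * x j\<bar> \<le> A i j" using A_nonneg[of i j] i j by (simp add: abs_mult)
  qed
  then have "\<bar>local_field i x\<bar> \<le> C + 1"
    using h row_sum[OF i] \<alpha>_less_1 unfolding local_field_def by linarith
  then have "tanh \<bar>local_field i x\<bar> \<le> tanh (C + 1)"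
    by (simp only: tanh_real_le_iff)
  then have "\<bar>tanh (local_field i x)\<bar> \<le> \<bar>tanh (C + 1)\<bar>"
    unfolding tanh_real_abs by linarith
  then have "(tanh (local_field i x))\<^sup>2 \<le> (tanh (C + 1))\<^sup>2"
    by (simp add: abs_le_square_iff)
  then show ?thesis
    by (simp add: cond_var_def plus_prob_def field_simps power2_eq_square)
qed

theorem corollary1p2:
  fixes A :: "nat \<Rightarrow> nat \<Rightarrow> nat \<Rightarrow> real"
    and h :: "nat \<Rightarrow> nat \<Rightarrow> real"
    and M :: "nat \<Rightarrow> 'a measure"
    and X :: "nat \<Rightarrow> nat \<Rightarrow> 'a \<Rightarrow> real"
    and W :: "nat \<Rightarrow> 'a \<Rightarrow> real"
    and \<alpha> :: real
    and \<mu> \<sigma> :: "nat \<Rightarrow> real"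
  assumes symmetric: "\<And>n i j. n \<ge> 1 \<Longrightarrow> i \<in> {1..n} \<Longrightarrow> j \<in> {1..n} \<Longrightarrow> A n i j = A n j i"
    and offdiag_nonneg:
      "\<And>n i j. n \<ge> 1 \<Longrightarrow> i \<in> {1..n} \<Longrightarrow> j \<in> {1..n} \<Longrightarrow> i \<noteq> j \<Longrightarrow> A n i j \<ge> 0"
    and ising: "\<And>n. n \<ge> 1 \<Longrightarrow> follows_ising (M n) n (A n) (h n) (X n)"
    and row_sums: "\<And>n. n \<ge> 1 \<Longrightarrow> max_offdiag_row_sum n (A n) \<le> \<alpha>"
    and "\<alpha> < 1"
    and W_def: "\<And>n. W n = scaled_magnetization n (X n)"
    and mu_def: "\<And>n. \<mu> n = prob_space.expectation (M n) (W n)"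
    and sigma_def: "\<And>n. \<sigma> n = sqrt (prob_space.variance (M n) (W n))"
  shows "(\<lambda>n. wasserstein2 (distr (M n) borel (W n)) (normal_law (\<mu> n) ((\<sigma> n)\<^sup>2)))
           \<longlonglongrightarrow> 0 \<and>
         ((\<exists>C. \<forall>n\<ge>1. (SUP i\<in>{1..n}. \<bar>h n i\<bar>) \<le> C) \<longrightarrow>
           weak_conv_m (\<lambda>n. distr (M n) borel (\<lambda>\<omega>. (W n \<omega> - \<mu> n) / \<sigma> n))
             std_normal_distribution)"
proof -
  have hti: "high_temp_ising n (A n) \<alpha>" if "n \<ge> 1" for n
    using that symmetric offdiag_nonneg row_sums \<open>\<alpha> < 1\<close> by (intro high_temp_ising_of_row_sum) auto
  note moments = high_temp_ising.scaled_magnetization_moments[OF hti ising, folded W_def, folded mu_def]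
  let ?V = "\<lambda>n \<omega>. (W n \<omega> - \<mu> n) / \<sigma> n"
  let ?L = "\<lambda>n. distr (M n) borel (?V n)"
  let ?w = "\<lambda>n. wasserstein2 (distr (M n) borel (W n)) (normal_law (\<mu> n) ((\<sigma> n)\<^sup>2))"
  have prob: "prob_space (M n)" if "n \<ge> 1" for n
    using ising[OF that] by (simp add: follows_ising_def)
  have W_meas: "W n \<in> borel_measurable (M n)" if "n \<ge> 1" for n
    using that by (rule moments(1)[OF that])
  have \<sigma>_nonneg: "0 \<le> \<sigma> n" for n
    unfolding sigma_def by (intro real_sqrt_ge_zero integral_nonneg_AE) auto
  have var: "(\<sigma> n)\<^sup>2 = (LINT \<omega>|M n. (W n \<omega> - \<mu> n)\<^sup>2)" for n
    unfolding sigma_def mu_def by (intro real_sqrt_pow2 integral_nonneg_AE) auto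
  have second_moment: "(\<integral>\<^sup>+ \<omega>. ennreal ((W n \<omega> - \<mu> n)\<^sup>2) \<partial>M n) = ennreal ((\<sigma> n)\<^sup>2)" if "n \<ge> 1" for n
    unfolding var using moments(4)[OF that that] by (intro nn_integral_eq_integral) auto
  have \<sigma>_le: "\<sigma> n \<le> sqrt (1 / (1 - \<alpha>))" if "n \<ge> 1" for n
  proof -
    have "prob_space.variance (M n) (W n) \<le> 1 / (1 - \<alpha>)"
      using high_temp_ising.variance_bounds(1)[OF hti[OF that], of "h n"] that \<open>\<alpha> < 1\<close>
      unfolding moments(3)[OF that that, folded mu_def] mu_def[symmetric] by (simp add: field_simps)
    then show ?thesis unfolding sigma_def by simp
  qed
  have real_distr: "real_distribution (?L n)" if "n \<ge> 1" for n
  proof -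
    interpret prob_space "M n" by (rule prob[OF that])
    note W_meas[OF that, measurable]
    show ?thesis by (rule real_distribution_distr) measurable
  qed
  \<comment> \<open>Stated along index sequences so as to serve both claims: a subsequence far from
    normal in the first, all positive indices in the second.\<close>
  have clt: "weak_conv_m (\<lambda>k. ?L (r k)) std_normal_distribution"
    if r: "\<And>k. 1 \<le> r k" "filterlim r sequentially sequentially" and "0 < \<delta>" "\<And>k. \<delta> \<le> \<sigma> (r k)"
    for r :: "nat \<Rightarrow> nat" and \<delta>
  proof (rule levy_continuity)
    show "real_distribution (?L (r k))" for k by (rule real_distr[OF r(1)])
    show "real_distribution std_normal_distribution" by (rule real_dist_normal_dist)
    fix t
    let ?C = "2 * \<bar>t\<bar> * (3 * (1 / (1 - \<alpha>)) ^ 3 * (\<bar>t\<bar> / \<delta>\<^sup>2 + t\<^sup>2 / \<delta> ^ 3))"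
    have "(\<lambda>n. ?C / sqrt (real n)) \<longlonglongrightarrow> 0"
      by (intro tendsto_divide_0[OF tendsto_const] filterlim_at_top_imp_at_infinity
          filterlim_compose[OF sqrt_at_top] filterlim_real_sequentially)
    then have lim: "(\<lambda>k. ?C / sqrt (real (r k))) \<longlonglongrightarrow> 0"
      using r(2) by (rule filterlim_compose)
    have bound: "cmod (char (?L (r k)) t - char std_normal_distribution t) \<le> ?C / sqrt (real (r k))" for k
      using high_temp_ising.char_standardized_bound[where t = t, OF hti[OF r(1)] ising[OF r(1)],
          folded W_def, folded sigma_def mu_def, OF \<open>0 < \<delta>\<close> that(4)]
      by (simp add: char_std_normal_distribution)
    have "(\<lambda>k. char (?L (r k)) t - char std_normal_distribution t) \<longlonglongrightarrow> 0"
      by (rule Lim_null_comparison[OF always_eventually lim]) (use bound in blast)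
    then show "(\<lambda>k. char (?L (r k)) t) \<longlonglongrightarrow> char std_normal_distribution t"
      by (rule LIM_zero_cancel)
  qed
  have "?w \<longlonglongrightarrow> 0"
  proof (rule ccontr)
    assume "\<not> ?w \<longlonglongrightarrow> 0"
    then obtain e where "0 < e" and e: "\<not> (\<forall>\<^sub>F n in sequentially. ?w n < e)"
      unfolding order_tendsto_iff by auto
    \<comment> \<open>The threshold \<open>e\<close> is an extended number and may be infinite; a
      finite one below it is needed.\<close>
    obtain \<epsilon> where \<epsilon>: "0 < \<epsilon>" "ennreal \<epsilon> \<le> e"
    proof (cases e)
      case (real u)
      then show ?thesis using \<open>0 < e\<close> that[of u] by auto
    next
      case top
      then show ?thesis using that[of 1] by auto
    qed
    have "infinite {n. ennreal \<epsilon> \<le> ?w n}"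
    proof
      assume "finite {n. ennreal \<epsilon> \<le> ?w n}"
      then have "\<forall>\<^sub>F n in sequentially. \<not> ennreal \<epsilon> \<le> ?w n"
        by (simp add: eventually_cofinite flip: cofinite_eq_sequentially)
      then have "\<forall>\<^sub>F n in sequentially. ?w n < e"
        by (rule eventually_mono) (use \<epsilon>(2) in \<open>simp add: not_le less_le_trans\<close>)
      with e show False ..
    qed
    from infinite_enumerate[OF this] obtain r0 :: "nat \<Rightarrow> nat"
      where r0: "strict_mono r0" "\<And>k. r0 k \<in> {n. ennreal \<epsilon> \<le> ?w n}"
      by blast
    \<comment> \<open>The shift keeps every index at least 1; the model is only assumed from there
      on.\<close>
    define r where "r k = r0 (Suc k)" for k
    have "strict_mono r" using r0(1) by (simp add: strict_mono_def r_def)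
    have r_ge: "1 \<le> r k" for k
      using strict_mono_imp_increasing[OF r0(1), of "Suc k"] by (simp add: r_def)
    have r_lim: "filterlim r sequentially sequentially"
      using \<open>strict_mono r\<close> by (rule filterlim_subseq)
    have w_ge: "ennreal \<epsilon> \<le> ?w (r k)" for k
      using r0(2)[of "Suc k"] by (simp add: r_def)
    \<comment> \<open>The independent coupling costs at most twice the standard deviation, so bad
      indices have standard deviations bounded below and \<open>clt\<close> applies to them.\<close>
    have \<sigma>_ge: "\<epsilon> / 2 \<le> \<sigma> (r k)" for k
    proof -
      have "?w (r k) \<le> ennreal (2 * \<sigma> (r k))"
        by (rule wasserstein2_normal_le[OF prob[OF r_ge] W_meas[OF r_ge] \<sigma>_nonneg second_moment[OF r_ge]])
      then have "ennreal \<epsilon> \<le> ennreal (2 * \<sigma> (r k))" using w_ge order_trans by blast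
      then show ?thesis using \<sigma>_nonneg by (simp add: ennreal_le_iff)
    qed
    have \<sigma>_pos: "0 < \<sigma> (r k)" for k using \<sigma>_ge[of k] \<epsilon>(1) by linarith
    have unit: "(\<integral>\<^sup>+ x. ennreal (x\<^sup>2) \<partial>?L (r k)) = 1" for k
    proof -
      note W_meas[OF r_ge, measurable]
      have "(\<integral>\<^sup>+ x. ennreal (x\<^sup>2) \<partial>?L (r k)) =
          (\<integral>\<^sup>+ \<omega>. ennreal (1 / (\<sigma> (r k))\<^sup>2) * ennreal ((W (r k) \<omega> - \<mu> (r k))\<^sup>2) \<partial>M (r k))"
        by (subst nn_integral_distr) (auto simp: power_divide simp flip: ennreal_mult')
      also have "\<dots> = ennreal (1 / (\<sigma> (r k))\<^sup>2) * ennreal ((\<sigma> (r k))\<^sup>2)"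
        by (subst nn_integral_cmult) (auto simp: second_moment[OF r_ge])
      also have "\<dots> = 1"
        using \<sigma>_pos[of k] by (simp flip: ennreal_mult')
      finally show ?thesis .
    qed
    \<comment> \<open>\<open>S\<close> bounds all standard deviations. A coupling of the
      standardized laws at distance \<open>d\<close> then costs at most
      \<open>S * d = \<epsilon> / 2\<close> after rescaling, contradicting
      \<open>w_ge\<close>.\<close>
    define S where "S = sqrt (1 / (1 - \<alpha>))"
    have "0 < S" using \<open>\<alpha> < 1\<close> by (simp add: S_def)
    define d where "d = \<epsilon> / (2 * S)"
    have "0 < d" using \<epsilon>(1) \<open>0 < S\<close> by (simp add: d_def)
    obtain k and N :: "real measure" and P Q where N: "prob_space N"
      and PQ [measurable]: "P \<in> borel_measurable N" "Q \<in> borel_measurable N"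
      and dP: "distr N borel P = ?L (r k)" and dQ: "distr N borel Q = std_normal_distribution"
      and le: "(\<integral>\<^sup>+ \<omega>. ennreal ((P \<omega> - Q \<omega>)\<^sup>2) \<partial>N) \<le> ennreal (d\<^sup>2)"
    proof (rule std_normal_L2_coupling[of "\<lambda>k. ?L (r k)" "d\<^sup>2"])
      show "weak_conv_m (\<lambda>k. ?L (r k)) std_normal_distribution"
        using \<epsilon>(1) \<sigma>_ge by (intro clt[where \<delta> = "\<epsilon> / 2"] r_ge r_lim) auto
    qed (use real_distr r_ge unit \<open>0 < d\<close> in auto)
    let ?m = "\<mu> (r k)" and ?s = "\<sigma> (r k)"
    \<comment> \<open>The affine map with slope \<open>?s\<close> and intercept \<open>?m\<close>
      carries the two standardized laws back to the original ones and multiplies the distance by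
      \<open>?s\<close>.\<close>
    have "?w (r k) \<le> ennreal (?s * d)"
    proof (rule wasserstein2_le[OF N, of "\<lambda>\<omega>. ?m + ?s * P \<omega>" "\<lambda>\<omega>. ?m + ?s * Q \<omega>"])
      note W_meas[OF r_ge, measurable]
      have "distr N borel (\<lambda>\<omega>. ?m + ?s * P \<omega>) = distr (distr N borel P) borel (\<lambda>x. ?m + ?s * x)"
        by (subst distr_distr) (auto simp: comp_def)
      also have "\<dots> = distr (M (r k)) borel (\<lambda>\<omega>. ?m + ?s * ?V (r k) \<omega>)"
        unfolding dP by (subst distr_distr) (auto simp: comp_def)
      also have "\<dots> = distr (M (r k)) borel (W (r k))"
        using \<sigma>_pos[of k] by simp
      finally show "distr N borel (\<lambda>\<omega>. ?m + ?s * P \<omega>) = distr (M (r k)) borel (W (r k))" .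
      have "distr N borel (\<lambda>\<omega>. ?m + ?s * Q \<omega>) = distr (distr N borel Q) borel (\<lambda>x. ?m + ?s * x)"
        by (subst distr_distr) (auto simp: comp_def)
      then show "distr N borel (\<lambda>\<omega>. ?m + ?s * Q \<omega>) = normal_law ?m (?s\<^sup>2)"
        unfolding dQ by (simp add: distr_std_normal_affine[OF \<sigma>_pos])
      have "(\<integral>\<^sup>+ \<omega>. ennreal (((?m + ?s * P \<omega>) - (?m + ?s * Q \<omega>))\<^sup>2) \<partial>N) =
          (\<integral>\<^sup>+ \<omega>. ennreal (?s\<^sup>2) * ennreal ((P \<omega> - Q \<omega>)\<^sup>2) \<partial>N)"
        by (intro nn_integral_cong) (simp flip: ennreal_mult right_diff_distrib power_mult_distrib)
      also have "\<dots> = ennreal (?s\<^sup>2) * (\<integral>\<^sup>+ \<omega>. ennreal ((P \<omega> - Q \<omega>)\<^sup>2) \<partial>N)"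
        by (rule nn_integral_cmult) measurable
      also have "\<dots> \<le> ennreal (?s\<^sup>2) * ennreal (d\<^sup>2)" using le by (rule mult_left_mono) simp
      also have "\<dots> = ennreal ((?s * d)\<^sup>2)" by (simp add: power_mult_distrib ennreal_mult)
      finally show "(\<integral>\<^sup>+ \<omega>. ennreal (((?m + ?s * P \<omega>) - (?m + ?s * Q \<omega>))\<^sup>2) \<partial>N) \<le> ennreal ((?s * d)\<^sup>2)" .
      show "0 \<le> ?s * d" using \<sigma>_nonneg \<open>0 < d\<close> by simp
    qed measurable
    then have "ennreal \<epsilon> \<le> ennreal (?s * d)" using w_ge[of k] by (rule order_trans[rotated])
    then have "\<epsilon> \<le> ?s * d" using \<sigma>_nonneg \<open>0 < d\<close> by (simp add: ennreal_le_iff)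
    also have "\<dots> \<le> S * d"
      using \<sigma>_le[OF r_ge] \<open>0 < d\<close> by (intro mult_right_mono) (auto simp: S_def)
    also have "\<dots> = \<epsilon> / 2" using \<open>0 < S\<close> by (simp add: d_def)
    finally show False using \<epsilon>(1) by simp
  qed
  moreover have "weak_conv_m ?L std_normal_distribution"
    if "\<forall>n\<ge>1. (SUP i\<in>{1..n}. \<bar>h n i\<bar>) \<le> C" for C
  proof -
    have h: "\<bar>h n i\<bar> \<le> C" if "n \<ge> 1" "i \<in> {1..n}" for n i
    proof -
      have "\<bar>h n i\<bar> \<le> (SUP i\<in>{1..n}. \<bar>h n i\<bar>)" using that by (intro cSUP_upper) auto
      then show ?thesis using \<open>\<forall>n\<ge>1. (SUP i\<in>{1..n}. \<bar>h n i\<bar>) \<le> C\<close> that by fastforce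
    qed
    \<comment> \<open>\<open>c / 4\<close> bounds \<open>cond_var\<close> from below, so the
      magnetization has variance at least \<open>c * n\<close>, and \<open>sqrt c\<close> is a lower
      bound for the standard deviation after scaling.\<close>
    define c where "c = 1 - (tanh (C + 1))\<^sup>2"
    have "0 < c" using tanh_real_bounds[of "C + 1"] by (simp add: c_def abs_square_less_1 abs_less_iff)
    have "sqrt c \<le> \<sigma> n" if n: "n \<ge> 1" for n
    proof -
      have "4 * (c / 4) * n \<le> high_temp_ising.ex n (A n) (h n)
          (\<lambda>x. (high_temp_ising.mag n x - high_temp_ising.ex n (A n) (h n) (high_temp_ising.mag n))\<^sup>2)"
        unfolding c_def using n \<open>0 < c\<close>
        by (intro high_temp_ising.variance_bounds(2)[OF hti[OF n]] high_temp_ising.cond_var_ge[OF hti[OF n]] h)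
          (auto simp: c_def)
      then have "c \<le> prob_space.variance (M n) (W n)"
        unfolding moments(3)[OF n n, folded mu_def] mu_def[symmetric] using n by (simp add: field_simps)
      then show ?thesis unfolding sigma_def by simp
    qed
    \<comment> \<open>The limit is first taken along \<open>Suc k\<close>, avoiding index 0, and
      then shifted back.\<close>
    then have "weak_conv_m (\<lambda>k. ?L (Suc k)) std_normal_distribution"
      using \<open>0 < c\<close> by (intro clt[where \<delta> = "sqrt c"] filterlim_Suc) auto
    then show ?thesis
      unfolding weak_conv_m_def weak_conv_def by (auto intro: LIMSEQ_imp_Suc)
  qed
  ultimately show ?thesis by blast
qed

end
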